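(* Let $G$ be a compact Hausdorff abelian torsion topological group. If $G$ is dense-subgroup-separable, then $G$ is metrizable; thus $G$ is dense-separable.
   Context: A group is a torsion group if each of its elements has finite order. A topological group is dense-subgroup-separable if each of its dense subgroups is separable. A space is dense-separable if each of its dense subspaces is separable. *)

theory Defs
  imports "HOL-Analysis.Analysis" "HOL-Algebra.Group"
begin

locale topological_group = group G for G (structure) +
  fixes T :: "'a topology"
  assumes topspace_eq_carrier: "topspace T = carrier G"
    and continuous_mult: "continuous_map (prod_topology T T) T (\<lambda>(x, y). x \<otimes> y)"
    and continuous_inv: "continuous_map T T (\<lambda>x. inv x)"

definition torsion_group :: "('a, 'b) monoid_scheme \<Rightarrow> bool" where
  "torsion_group G \<longleftrightarrow>
     group G \<and> (\<forall>x\<in>carrier G. \<exists>n::nat. n > 0 \<and> x [^]\<^bsub>G\<^esub> n = \<one>\<^bsub>G\<^esub>)"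

definition dense_subset :: "'a topology \<Rightarrow> 'a set \<Rightarrow> bool" where
  "dense_subset T D \<longleftrightarrow> D \<subseteq> topspace T \<and> T closure_of D = topspace T"

definition dense_separable :: "'a topology \<Rightarrow> bool" where
  "dense_separable T \<longleftrightarrow>
     (\<forall>D. dense_subset T D \<longrightarrow> separable_space (subtopology T D))"

definition dense_subgroup_separable :: "('a, 'b) monoid_scheme \<Rightarrow> 'a topology \<Rightarrow> bool" where
  "dense_subgroup_separable G T \<longleftrightarrow>
     (\<forall>H. subgroup H G \<and> dense_subset T H \<longrightarrow> separable_space (subtopology T H))"

end

theory Submission
  imports Defs "HOL-Computational_Algebra.Primes"
begin

text \<open>
  By Baire's theorem a compact Hausdorff abelian torsion group satisfies \<open>x [^] N = \<one>\<close> for some fixed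
  \<open>N > 0\<close> (\<open>compact_torsion_exponent\<close>), so its characters take values in the \<open>N\<close>-th roots of unity. Two
  facts carry the proof.

  First, continuous characters separate points from closed subgroups
  (\<open>dual_separates_closed_subgroup\<close>). Bounded exponent makes this elementary: every finite subset
  lies in a finite subgroup, and averaging over ever larger finite subgroups replaces Haar measure.
  Given a uniformly continuous \<open>f\<close> with \<open>f \<one> = 1\<close>, orthogonality of characters on a finite subgroup
  \<open>F\<close> produces a character of \<open>F\<close> whose Fourier coefficient against \<open>f\<close> is bounded below by a
  constant that does not depend on \<open>F\<close> (\<open>large_fourier_coefficient\<close>). Compactness of a product of
  finite sets turns these characters into one homomorphism \<open>\<phi>\<close> of the whole group that correlates with
  \<open>f\<close> on every finite subgroup, and uniform continuity of \<open>f\<close> then forces continuity of \<open>\<phi>\<close>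
  (\<open>dual_if_large_averages\<close>). A suitable choice of \<open>f\<close> makes \<open>\<phi>\<close> trivial on the given closed subgroup
  and nontrivial at the given point.

  Secondly, let \<open>p\<close> be a prime and choose a maximal independent family \<open>I\<close> of continuous characters
  of order dividing \<open>p\<close>. The subgroup \<open>H\<close> of points at which all but finitely many members of \<open>I\<close> are
  trivial is dense (\<open>dense_finite_support\<close>): a character that is trivial on the closure of \<open>H\<close> has
  order dividing \<open>p\<close>, because \<open>H\<close> contains all \<open>p\<close>-th powers, and depends on finitely many members
  of \<open>I\<close>, whose values can be prescribed by points of \<open>H\<close>. By hypothesis \<open>H\<close> is separable. A countable
  subset of \<open>H\<close> meets only countably many members of \<open>I\<close> nontrivially, so an uncountable \<open>I\<close> would
  contain a nontrivial character that is trivial on a dense set. Hence \<open>I\<close> is countable, and so is the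
  \<open>p\<close>-torsion of the dual group: a character in it is determined by its values at points dual to \<open>I\<close>,
  and only finitely many of these differ from 1.

  Since the dual group has exponent \<open>N\<close> and countable \<open>p\<close>-torsion for every prime \<open>p\<close>, it is countable
  (\<open>countable_dual\<close>). The fibres of its members form a countable family of clopen sets that separates
  points, and a compact space with such a family is metrizable and second countable. Subspaces of
  second countable spaces are separable.
\<close>

section \<open>Finite subgroups and their characters\<close>

locale bounded_comm_group = comm_group G for G (structure) +
  fixes N :: nat
  assumes exponent_pos: "N > 0"
    and exponent: "x \<in> carrier G \<Longrightarrow> x [^] N = \<one>"
begin

definition adjoin :: "'a set \<Rightarrow> 'a \<Rightarrow> 'a set" where
  "adjoin K a = {k \<otimes> a [^] j | k (j::nat). k \<in> K}"

text \<open>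
  Characters are extensional functions, so that a finite subgroup has only finitely many of them and
  sums over all characters make sense.
\<close>

definition characters :: "'a set \<Rightarrow> ('a \<Rightarrow> complex) set" where
  "characters F = {\<phi> \<in> extensional F. (\<forall>x\<in>F. \<phi> x \<noteq> 0) \<and>
     (\<forall>x\<in>F. \<forall>y\<in>F. \<phi> (x \<otimes> y) = \<phi> x * \<phi> y)}"

lemma inv_eq_pow: "x \<in> carrier G \<Longrightarrow> inv x = x [^] (N - 1)"
proof -
  assume x: "x \<in> carrier G"
  have "x [^] (N - 1) \<otimes> x = x [^] Suc (N - 1)" by simp
  also have "Suc (N - 1) = N" using exponent_pos by simp
  finally show "inv x = x [^] (N - 1)"
    using exponent[OF x] x by (simp add: inv_equality)
qed

lemma pow_mod_exponent: "x \<in> carrier G \<Longrightarrow> x [^] (j mod N) = x [^] j"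
proof -
  assume x: "x \<in> carrier G"
  have "x [^] j = x [^] (N * (j div N) + j mod N)" by simp
  also have "\<dots> = (x [^] N) [^] (j div N) \<otimes> x [^] (j mod N)"
    using x by (simp only: nat_pow_mult nat_pow_pow nat_pow_closed)
  finally show ?thesis using exponent x by simp
qed

lemma subgroup_pow_closed: "subgroup K G \<Longrightarrow> x \<in> K \<Longrightarrow> x [^] (n::nat) \<in> K"
  by (induction n) (auto simp: subgroup.one_closed subgroup.m_closed)

lemma adjoin_least:
  assumes "subgroup F G" "K \<subseteq> F" "a \<in> F"
  shows "adjoin K a \<subseteq> F"
  using assms by (auto simp: adjoin_def subgroup_pow_closed subgroup.m_closed subset_iff)

lemma adjoin_incl:
  assumes "subgroup K G" "a \<in> carrier G"
  shows "K \<subseteq> adjoin K a" "a \<in> adjoin K a"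
proof -
  show "K \<subseteq> adjoin K a"
  proof
    fix k assume "k \<in> K"
    then have "k = k \<otimes> a [^] (0::nat)" using assms subgroup.mem_carrier by fastforce
    then show "k \<in> adjoin K a" using \<open>k \<in> K\<close> unfolding adjoin_def by blast
  qed
  have "a = \<one> \<otimes> a [^] (1::nat)" using assms by simp
  then show "a \<in> adjoin K a"
    using subgroup.one_closed[OF assms(1)] unfolding adjoin_def by blast
qed

lemma subgroup_adjoin:
  assumes K: "subgroup K G" and a: "a \<in> carrier G"
  shows "subgroup (adjoin K a) G"
proof (rule subgroupI)
  note Kc = subgroup.mem_carrier[OF K]
  show "adjoin K a \<subseteq> carrier G" using a Kc by (auto simp: adjoin_def)
  show "adjoin K a \<noteq> {}" using adjoin_incl[OF K a] by blast
  show "inv x \<in> adjoin K a" if "x \<in> adjoin K a" for x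
  proof -
    from that obtain k and j :: nat where kj: "x = k \<otimes> a [^] j" "k \<in> K"
      unfolding adjoin_def by blast
    then have "inv x = inv k \<otimes> a [^] (j * (N - 1))"
      using a Kc by (simp add: inv_mult inv_eq_pow[of "a [^] j"] nat_pow_pow)
    then show ?thesis using kj subgroup.m_inv_closed[OF K] unfolding adjoin_def by blast
  qed
  show "x \<otimes> y \<in> adjoin K a" if xy: "x \<in> adjoin K a" "y \<in> adjoin K a" for x y
  proof -
    from xy obtain k i l j where kl: "x = k \<otimes> a [^] (i::nat)" "k \<in> K" "y = l \<otimes> a [^] (j::nat)" "l \<in> K"
      unfolding adjoin_def by blast
    then have "x \<otimes> y = (k \<otimes> l) \<otimes> a [^] (i + j)"
      using a Kc by (simp add: m_ac flip: nat_pow_mult)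
    then show ?thesis using kl subgroup.m_closed[OF K] unfolding adjoin_def by blast
  qed
qed

lemma finite_adjoin:
  assumes "finite K" "a \<in> carrier G"
  shows "finite (adjoin K a)"
proof -
  have "adjoin K a \<subseteq> (\<lambda>(k, j::nat). k \<otimes> a [^] j) ` (K \<times> {..<N})"
  proof
    fix x assume "x \<in> adjoin K a"
    then obtain k and j :: nat where "x = k \<otimes> a [^] j" "k \<in> K" unfolding adjoin_def by blast
    then have "x = (\<lambda>(k, j::nat). k \<otimes> a [^] j) (k, j mod N)" "(k, j mod N) \<in> K \<times> {..<N}"
      using assms exponent_pos by (auto simp: pow_mod_exponent)
    then show "x \<in> (\<lambda>(k, j::nat). k \<otimes> a [^] j) ` (K \<times> {..<N})" by blast
  qed
  then show ?thesis using assms by (meson finite_SigmaI finite_imageI finite_lessThan finite_subset)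
qed

text \<open>
  Bounded exponent makes finitely generated subgroups finite. So the finite subgroups form a directed
  family that exhausts the group, and averaging over them can replace integration.
\<close>

lemma finite_subgroup_containing:
  assumes "finite S" "S \<subseteq> carrier G"
  obtains F where "subgroup F G" "finite F" "S \<subseteq> F"
proof -
  have "\<exists>F. subgroup F G \<and> finite F \<and> S \<subseteq> F" using assms
  proof (induction S rule: finite_induct)
    case empty
    show ?case using triv_subgroup by blast
  next
    case (insert a S)
    then obtain F where F: "subgroup F G" "finite F" "S \<subseteq> F" by auto
    with insert.prems have "subgroup (adjoin F a) G" "finite (adjoin F a)"
      "insert a S \<subseteq> adjoin F a"
      using subgroup_adjoin finite_adjoin adjoin_incl[of F a] by auto
    then show ?case by blast
  qed
  then show ?thesis using that by blast
qed

lemma charactersD: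
  assumes "\<phi> \<in> characters F"
  shows "x \<in> F \<Longrightarrow> \<phi> x \<noteq> 0" "x \<in> F \<Longrightarrow> y \<in> F \<Longrightarrow> \<phi> (x \<otimes> y) = \<phi> x * \<phi> y" "\<phi> \<in> extensional F"
  using assms by (auto simp: characters_def)

lemma char_one:
  assumes "subgroup F G" "\<phi> \<in> characters F"
  shows "\<phi> \<one> = 1"
proof -
  have o: "\<one> \<in> F" using assms(1) subgroup.one_closed by blast
  then have "\<phi> \<one> * \<phi> \<one> = \<phi> \<one>" using charactersD(2)[OF assms(2) o o] by simp
  then show ?thesis using charactersD(1)[OF assms(2) o] by simp
qed

lemma char_pow:
  assumes F: "subgroup F G" and \<phi>: "\<phi> \<in> characters F" and x: "x \<in> F"
  shows "\<phi> (x [^] (n::nat)) = \<phi> x ^ n"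
  by (induction n) (use assms in \<open>auto simp: char_one charactersD(2)[OF \<phi>] subgroup_pow_closed mult.commute\<close>)

lemma char_root:
  assumes F: "subgroup F G" and \<phi>: "\<phi> \<in> characters F" and x: "x \<in> F"
  shows "\<phi> x ^ N = 1" "cmod (\<phi> x) = 1"
proof -
  show 1: "\<phi> x ^ N = 1"
    using char_pow[OF assms, of N] exponent subgroup.mem_carrier[OF F x] char_one[OF F \<phi>] by simp
  then show "cmod (\<phi> x) = 1"
    using exponent_pos by (metis norm_ge_zero norm_one norm_power power_eq_1_iff neq0_conv)
qed

lemma char_inv:
  assumes F: "subgroup F G" and \<phi>: "\<phi> \<in> characters F" and x: "x \<in> F"
  shows "\<phi> (inv x) = inverse (\<phi> x)" "\<phi> (inv x) = cnj (\<phi> x)"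
proof -
  have i: "inv x \<in> F" by (rule subgroup.m_inv_closed[OF F x])
  have "\<phi> (inv x) * \<phi> x = 1"
    using charactersD(2)[OF \<phi> i x] subgroup.mem_carrier[OF F x] char_one[OF F \<phi>] by simp
  then show 1: "\<phi> (inv x) = inverse (\<phi> x)" by (metis inverse_unique mult.commute)
  show "\<phi> (inv x) = cnj (\<phi> x)"
    using 1 char_root(2)[OF assms] by (simp add: inverse_eq_divide divide_conv_cnj)
qed

lemma finite_characters:
  assumes F: "subgroup F G" and "finite F"
  shows "finite (characters F)"
proof -
  have "\<phi> \<in> PiE F (\<lambda>_. {z. z ^ N = 1})" if "\<phi> \<in> characters F" for \<phi>
    unfolding PiE_iff using char_root(1)[OF F that] charactersD(3)[OF that] by blast
  then have "characters F \<subseteq> PiE F (\<lambda>_. {z. z ^ N = 1})" by blast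
  moreover have "finite (PiE F (\<lambda>_. {z::complex. z ^ N = 1}))"
    using \<open>finite F\<close> exponent_pos by (intro finite_PiE finite_roots_unity) auto
  ultimately show ?thesis by (rule finite_subset)
qed

lemma char_restrict:
  assumes "\<phi> \<in> characters F" "K \<subseteq> F" "subgroup K G"
  shows "restrict \<phi> K \<in> characters K"
  using assms subgroup.m_closed[OF assms(3)] by (auto simp: characters_def subset_iff)

lemma char_mult:
  assumes "\<phi> \<in> characters F" "\<psi> \<in> characters F" "subgroup F G"
  shows "(\<lambda>x\<in>F. \<phi> x * \<psi> x) \<in> characters F"
  using assms subgroup.m_closed[OF assms(3)] by (auto simp: characters_def)

text \<open>
  If \<open>m\<close> is the order of \<open>a\<close> modulo \<open>K\<close>, an extension is determined by its value \<open>\<zeta>\<close> at \<open>a\<close>, and every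
  \<open>m\<close>-th root of \<open>\<phi> (a [^] m)\<close> is admissible. As \<open>m \<ge> 2\<close>, one of these roots differs from 1.
\<close>

lemma char_extend_adjoin:
  assumes K: "subgroup K G" and \<phi>: "\<phi> \<in> characters K" and a: "a \<in> carrier G" "a \<notin> K"
  obtains \<psi> where "\<psi> \<in> characters (adjoin K a)" "\<And>x. x \<in> K \<Longrightarrow> \<psi> x = \<phi> x" "\<psi> a \<noteq> 1"
proof -
  note Kc = subgroup.mem_carrier[OF K]
  define m where "m = (LEAST m::nat. 0 < m \<and> a [^] m \<in> K)"
  have "0 < N \<and> a [^] N \<in> K" using exponent a exponent_pos subgroup.one_closed[OF K] by simp
  then have m: "0 < m \<and> a [^] m \<in> K" unfolding m_def by (rule LeastI)
  have m_least: "m \<le> j" if "0 < j" "a [^] j \<in> K" for j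
    unfolding m_def using that by (intro Least_le) auto
  have "a [^] (1::nat) = a" using a by simp
  then have "m \<noteq> 1" using m a by metis
  with m have m2: "m \<ge> 2" by linarith
  have m_dvd: "m dvd j" if j: "a [^] j \<in> K" for j
  proof -
    have "a [^] j = (a [^] m) [^] (j div m) \<otimes> a [^] (j mod m)"
      using a by (simp add: nat_pow_mult nat_pow_pow)
    moreover have "(a [^] m) [^] (j div m) \<in> K" using m K subgroup_pow_closed by blast
    ultimately have "a [^] (j mod m) = inv ((a [^] m) [^] (j div m)) \<otimes> a [^] j"
      using a by (simp add: inv_solve_left)
    then have "a [^] (j mod m) \<in> K"
      using j \<open>(a [^] m) [^] (j div m) \<in> K\<close> K by (simp add: subgroup.m_closed subgroup.m_inv_closed)
    then show ?thesis using m_least[of "j mod m"] m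
      by (metis dvd_eq_mod_eq_0 leD mod_less_divisor neq0_conv)
  qed
  obtain \<zeta> where \<zeta>: "\<zeta> ^ m = \<phi> (a [^] m)" "\<zeta> \<noteq> 1"
  proof (cases "\<phi> (a [^] m) = 1")
    case True
    have "card {z::complex. z ^ m = 1} = m" using m by (intro card_roots_unity_eq) auto
    then have "\<not> {z::complex. z ^ m = 1} \<subseteq> {1}" using m2
      by (metis card_mono finite.emptyI finite_insert is_singleton_altdef is_singletonI not_less_eq_eq numeral_2_eq_2 One_nat_def)
    then show ?thesis using True that by auto
  next
    case False
    obtain z where "z ^ m = \<phi> (a [^] m)"
      using m that by (metis exists_complex_root neq0_conv)
    then show ?thesis using False that[of z] by force
  qed
  \<comment> \<open>The value \<open>\<phi> k * \<zeta> ^ i\<close> depends only on the element \<open>k \<otimes> a [^] i\<close>, because \<open>m\<close> divides the difference of two exponents of \<open>a\<close> that occur for it.\<close>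
  have wd0: "\<phi> k * \<zeta> ^ i = \<phi> l * \<zeta> ^ j"
    if "k \<in> K" "l \<in> K" "k \<otimes> a [^] i = l \<otimes> a [^] j" "j \<le> i" for k l and i j :: nat
  proof -
    have "l \<otimes> a [^] j = (k \<otimes> a [^] (i - j)) \<otimes> a [^] j"
      using that a Kc by (simp add: m_assoc nat_pow_mult)
    then have l: "l = k \<otimes> a [^] (i - j)" using that a Kc by simp
    then have "a [^] (i - j) = inv k \<otimes> l" using that a Kc by (simp add: inv_solve_left)
    then have "a [^] (i - j) \<in> K" using that K by (simp add: subgroup.m_closed subgroup.m_inv_closed)
    then obtain q where q: "i - j = m * q" using m_dvd by blast
    have "l = k \<otimes> (a [^] m) [^] q" using l q a by (simp add: nat_pow_pow)
    then have "\<phi> l = \<phi> k * \<phi> (a [^] m) ^ q"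
      using that m K \<phi> by (simp add: charactersD(2) subgroup_pow_closed char_pow)
    also have "\<dots> = \<phi> k * \<zeta> ^ (i - j)" by (simp add: q power_mult flip: \<zeta>(1))
    finally show ?thesis using \<open>j \<le> i\<close> by (simp add: mult.assoc flip: power_add)
  qed
  then have wd: "\<phi> k * \<zeta> ^ i = \<phi> l * \<zeta> ^ j"
    if "k \<in> K" "l \<in> K" "k \<otimes> a [^] i = l \<otimes> a [^] j" for k l and i j :: nat
    using that by (metis nat_le_linear)
  define \<psi> where "\<psi> = (\<lambda>x\<in>adjoin K a. SOME z. \<exists>k\<in>K. \<exists>j::nat. x = k \<otimes> a [^] j \<and> z = \<phi> k * \<zeta> ^ j)"
  have \<psi>: "\<psi> (k \<otimes> a [^] j) = \<phi> k * \<zeta> ^ j" if "k \<in> K" for k and j :: nat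
  proof -
    have "\<exists>k'\<in>K. \<exists>j'::nat. k \<otimes> a [^] j = k' \<otimes> a [^] j' \<and> \<phi> k * \<zeta> ^ j = \<phi> k' * \<zeta> ^ j'"
      using that by blast
    then have "\<exists>k'\<in>K. \<exists>j'::nat. k \<otimes> a [^] j = k' \<otimes> a [^] j' \<and> 
       (SOME z. \<exists>k'\<in>K. \<exists>j'::nat. k \<otimes> a [^] j = k' \<otimes> a [^] j' \<and> z = \<phi> k' * \<zeta> ^ j') = \<phi> k' * \<zeta> ^ j'"
      by (rule someI)
    moreover have "k \<otimes> a [^] j \<in> adjoin K a" using that unfolding adjoin_def by blast
    ultimately show ?thesis using wd[OF that] unfolding \<psi>_def by auto
  qed
  have K\<psi>: "\<psi> x = \<phi> x" if "x \<in> K" for x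
    using \<psi>[OF that, of 0] that Kc by simp
  have "\<psi> a = \<zeta>"
    using \<psi>[OF subgroup.one_closed[OF K], of 1] a char_one[OF K \<phi>] by simp
  moreover have "\<zeta> \<noteq> 0" using \<zeta>(1) charactersD(1)[OF \<phi>, of "a [^] m"] m by (auto simp: power_0_left)
  have "\<psi> \<in> characters (adjoin K a)"
    unfolding characters_def
  proof (intro CollectI conjI ballI)
    show "\<psi> \<in> extensional (adjoin K a)" unfolding \<psi>_def by simp
    show "\<psi> x \<noteq> 0" if "x \<in> adjoin K a" for x
      using that \<psi> charactersD(1)[OF \<phi>] \<open>\<zeta> \<noteq> 0\<close> by (auto simp: adjoin_def)
    show "\<psi> (x \<otimes> y) = \<psi> x * \<psi> y" if xy: "x \<in> adjoin K a" "y \<in> adjoin K a" for x y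
    proof -
      from xy obtain k i l j where kl: "x = k \<otimes> a [^] (i::nat)" "k \<in> K" "y = l \<otimes> a [^] (j::nat)" "l \<in> K"
        unfolding adjoin_def by blast
      then have "x \<otimes> y = (k \<otimes> l) \<otimes> a [^] (i + j)"
        using a Kc by (simp add: m_ac flip: nat_pow_mult)
      then show ?thesis
        using kl \<psi> subgroup.m_closed[OF K kl(2) kl(4)] charactersD(2)[OF \<phi>]
        by (simp add: power_add)
    qed
  qed
  ultimately show ?thesis using that K\<psi> \<zeta>(2) by metis
qed

lemma char_extend:
  assumes F: "subgroup F G" "finite F" and "subgroup K G" "K \<subseteq> F" "\<phi> \<in> characters K"
  obtains \<psi> where "\<psi> \<in> characters F" "\<And>x. x \<in> K \<Longrightarrow> \<psi> x = \<phi> x"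
proof -
  have "\<exists>\<psi>\<in>characters F. \<forall>x\<in>K. \<psi> x = \<phi> x" using assms(3-5)
  proof (induction "card F - card K" arbitrary: K \<phi> rule: less_induct)
    case less
    show ?case
    proof (cases "K = F")
      case True
      then show ?thesis using less.prems by blast
    next
      case False
      then obtain a where a: "a \<in> F" "a \<notin> K" using less.prems by blast
      have aG: "a \<in> carrier G" using a(1) by (rule subgroup.mem_carrier[OF F(1)])
      let ?L = "adjoin K a"
      obtain \<psi> where \<psi>: "\<psi> \<in> characters ?L" "\<And>x. x \<in> K \<Longrightarrow> \<psi> x = \<phi> x"
        by (rule char_extend_adjoin[OF less.prems(1,3) aG a(2)]) blast
      have L: "?L \<subseteq> F" "K \<subseteq> ?L" "a \<in> ?L" "subgroup ?L G"
        using adjoin_least adjoin_incl subgroup_adjoin less.prems a aG F by auto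
      have "K \<subset> ?L" using L a by blast
      then have "card K < card ?L" "card ?L \<le> card F"
        using F L by (meson finite_subset psubset_card_mono, meson F(2) L(1) card_mono)
      then obtain \<theta> where "\<theta> \<in> characters F" "\<forall>x\<in>?L. \<theta> x = \<psi> x"
        using less.hyps[of ?L \<psi>] L \<psi> by (metis diff_less_mono2 less_le_trans)
      then show ?thesis using \<psi> L by (metis subsetD)
    qed
  qed
  then show ?thesis using that by blast
qed

lemma characters_separate:
  assumes F: "subgroup F G" "finite F" and a: "a \<in> F" "a \<noteq> \<one>"
  obtains \<phi> where "\<phi> \<in> characters F" "\<phi> a \<noteq> 1"
proof -
  have triv: "subgroup {\<one>} G" by (rule triv_subgroup)
  have aG: "a \<in> carrier G" by (rule subgroup.mem_carrier[OF F(1) a(1)])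
  have "(\<lambda>x\<in>{\<one>}. 1) \<in> characters {\<one>}" by (auto simp: characters_def)
  then obtain \<psi> where \<psi>: "\<psi> \<in> characters (adjoin {\<one>} a)" "\<psi> a \<noteq> 1"
    using char_extend_adjoin[OF triv _ aG, of "\<lambda>x\<in>{\<one>}. 1"] a by blast
  have "adjoin {\<one>} a \<subseteq> F" by (rule adjoin_least) (use F a subgroup.one_closed in auto)
  then obtain \<phi> where "\<phi> \<in> characters F" "\<And>x. x \<in> adjoin {\<one>} a \<Longrightarrow> \<phi> x = \<psi> x"
    using char_extend[OF F subgroup_adjoin[OF triv aG] _ \<psi>(1)] by metis
  then show ?thesis using that \<psi> adjoin_incl[OF triv aG] by metis
qed

text \<open>
  Multiplication by a character \<open>\<psi>\<close> with \<open>\<psi> a \<noteq> 1\<close> permutes the characters and multiplies the sum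
  by \<open>\<psi> a\<close>.
\<close>

lemma sum_characters_zero:
  assumes F: "subgroup F G" "finite F" and a: "a \<in> F" "a \<noteq> \<one>"
  shows "(\<Sum>\<phi>\<in>characters F. \<phi> a) = 0"
proof -
  obtain \<psi> where \<psi>: "\<psi> \<in> characters F" "\<psi> a \<noteq> 1" using characters_separate[OF assms] by blast
  let ?t = "\<lambda>\<phi>. \<lambda>x\<in>F. \<psi> x * \<phi> x"
  have inj: "inj_on ?t (characters F)"
  proof (rule inj_onI)
    fix \<phi> \<theta> assume *: "\<phi> \<in> characters F" "\<theta> \<in> characters F" "?t \<phi> = ?t \<theta>"
    show "\<phi> = \<theta>"
    proof (rule extensionalityI[of _ F])
      fix x assume x: "x \<in> F"
      with *(3) have "\<psi> x * \<phi> x = \<psi> x * \<theta> x" by (metis (no_types, lifting) restrict_apply')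
      then show "\<phi> x = \<theta> x" using charactersD(1)[OF \<psi>(1) x] by simp
    qed (use * charactersD(3) in auto)
  qed
  have "?t ` characters F = characters F"
    using char_mult[OF \<psi>(1) _ F(1)] inj finite_characters[OF F]
    by (intro endo_inj_surj) auto
  then have "(\<Sum>\<phi>\<in>characters F. \<phi> a) = (\<Sum>\<phi>\<in>characters F. ?t \<phi> a)"
    using sum.reindex[OF inj, of "\<lambda>\<phi>. \<phi> a"] by simp
  also have "\<dots> = \<psi> a * (\<Sum>\<phi>\<in>characters F. \<phi> a)"
    using a by (simp add: sum_distrib_left)
  finally show ?thesis using \<psi> by (metis mult_cancel_right2)
qed

lemma sum_nontrivial_character:
  assumes F: "subgroup F G" "finite F" and \<phi>: "\<phi> \<in> characters F" and b: "b \<in> F" "\<phi> b \<noteq> 1"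
  shows "(\<Sum>x\<in>F. \<phi> x) = 0"
proof -
  have "bij_betw (\<lambda>x. b \<otimes> x) F F"
  proof (rule bij_betwI[where g = "\<lambda>x. inv b \<otimes> x"])
    show "(\<otimes>) b \<in> F \<rightarrow> F" "(\<otimes>) (inv b) \<in> F \<rightarrow> F"
      using F b by (auto simp: subgroup.m_closed subgroup.m_inv_closed)
    show "inv b \<otimes> (b \<otimes> x) = x" "b \<otimes> (inv b \<otimes> x) = x" if "x \<in> F" for x
      using subgroup.mem_carrier[OF F(1)] that b by (auto simp flip: m_assoc)
  qed
  then have "(\<Sum>x\<in>F. \<phi> x) = (\<Sum>x\<in>F. \<phi> (b \<otimes> x))"
    by (rule sum.reindex_bij_betw[symmetric])
  also have "\<dots> = \<phi> b * (\<Sum>x\<in>F. \<phi> x)"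
    using b charactersD(2)[OF \<phi>] by (simp add: sum_distrib_left)
  finally show ?thesis using b by (metis mult_cancel_right2)
qed

lemma sum_characters_one:
  assumes F: "subgroup F G"
  shows "(\<Sum>\<phi>\<in>characters F. \<phi> \<one>) = of_nat (card (characters F))"
proof -
  have "(\<Sum>\<phi>\<in>characters F. \<phi> \<one>) = (\<Sum>\<phi>\<in>characters F. 1)"
    using char_one[OF F] by (rule sum.cong[OF refl])
  then show ?thesis by simp
qed

text \<open>
  Sum \<open>\<phi> x\<close> over all \<open>\<phi>\<close> and all \<open>x\<close> in both orders: only \<open>x = \<one>\<close>, respectively only the trivial
  character, contributes.
\<close>

lemma card_characters:
  assumes F: "subgroup F G" "finite F"
  shows "card (characters F) = card F"
proof -
  let ?one = "\<lambda>x\<in>F. 1 :: complex"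
  have one: "?one \<in> characters F"
    using subgroup.m_closed[OF F(1)] by (auto simp: characters_def)
  have "(\<Sum>x\<in>F. \<Sum>\<phi>\<in>characters F. \<phi> x) = (\<Sum>x\<in>F. if x = \<one> then of_nat (card (characters F)) else 0)"
    using sum_characters_zero[OF F] sum_characters_one[OF F(1)] by (intro sum.cong) auto
  also have "\<dots> = of_nat (card (characters F))"
    using F subgroup.one_closed[OF F(1)] by simp
  finally have 1: "(\<Sum>x\<in>F. \<Sum>\<phi>\<in>characters F. \<phi> x) = of_nat (card (characters F))" .
  have "(\<Sum>x\<in>F. \<phi> x) = (if \<phi> = ?one then of_nat (card F) else 0)" if \<phi>: "\<phi> \<in> characters F" for \<phi>
  proof (cases "\<phi> = ?one")
    case False
    then obtain b where "b \<in> F" "\<phi> b \<noteq> 1"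
      using extensionalityI[OF charactersD(3)[OF \<phi>] charactersD(3)[OF one]] by (metis restrict_apply')
    then show ?thesis using False sum_nontrivial_character[OF F \<phi>] by simp
  qed simp
  then have "(\<Sum>\<phi>\<in>characters F. \<Sum>x\<in>F. \<phi> x) = (\<Sum>\<phi>\<in>characters F. if \<phi> = ?one then of_nat (card F) else 0)"
    by (intro sum.cong) auto
  also have "\<dots> = of_nat (card F)"
    using one finite_characters[OF F] by simp
  finally show ?thesis using 1 sum.swap[of "\<lambda>x \<phi>. \<phi> x" "characters F" F] by (metis of_nat_eq_iff)
qed

lemma sum_characters:
  assumes F: "subgroup F G" "finite F" and a: "a \<in> F"
  shows "(\<Sum>\<phi>\<in>characters F. \<phi> a) = (if a = \<one> then of_nat (card F) else 0)"
  using sum_characters_zero[OF F a] card_characters[OF F] sum_characters_one[OF F(1)] by auto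

section \<open>Large Fourier coefficients on finite subgroups\<close>

lemma mult_inv_eq_one_iff: "x \<in> carrier G \<Longrightarrow> y \<in> carrier G \<Longrightarrow> x \<otimes> inv y = \<one> \<longleftrightarrow> y = x"
  using inv_solve_right[of "\<one>" x y] by auto

text \<open>
  Write \<open>c \<phi>\<close> for the coefficient of \<open>f\<close> and \<open>w \<phi>\<close> for the sum of \<open>\<phi>\<close> over \<open>W\<close>. Orthogonality gives
  both the Parseval identity \<open>(\<Sum>\<phi>. \<bar>w \<phi>\<bar>\<^sup>2) = card F * card W\<close> and
  \<open>(\<Sum>\<phi>. c \<phi> * \<bar>w \<phi>\<bar>\<^sup>2) = card F * (\<Sum>x\<in>W. \<Sum>y\<in>W. f (x \<otimes> inv y))\<close>. The right-hand side of the second is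
  at least \<open>card F * d * (card W)\<^sup>2\<close>, so some \<open>\<bar>c \<phi>\<bar>\<close> is at least \<open>d * card W\<close>. The bound depends on \<open>F\<close>
  only through the density of \<open>W\<close> in \<open>F\<close>, which is at least \<open>1 / k\<close>.
\<close>

lemma large_fourier_coefficient:
  fixes f :: "'a \<Rightarrow> real" and d :: real and k :: nat
  assumes F: "subgroup F G" "finite F" and W: "W \<subseteq> F"
    and f: "\<And>x y. x \<in> W \<Longrightarrow> y \<in> W \<Longrightarrow> d \<le> f (x \<otimes> inv y)"
    and k: "card F \<le> k * card W" and d: "d \<ge> 0"
  obtains \<phi> where "\<phi> \<in> characters F" "d * card F \<le> k * cmod (\<Sum>a\<in>F. of_real (f a) * \<phi> (inv a))"
proof -
  let ?c = "\<lambda>\<phi>. \<Sum>a\<in>F. of_real (f a) * \<phi> (inv a) :: complex"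
  let ?w = "\<lambda>\<phi>. \<Sum>x\<in>W. \<phi> x :: complex"
  note Fc = subgroup.mem_carrier[OF F(1)]
  have finW: "finite W" using W F finite_subset by blast
  have "card F > 0" using F subgroup.one_closed[OF F(1)] by (auto simp: card_gt_0_iff)
  then have W0: "card W > 0" using k by (metis gr0I less_nat_zero_code mult_0_right not_le)
  have expand: "?w \<phi> * cnj (?w \<phi>) = (\<Sum>x\<in>W. \<Sum>y\<in>W. \<phi> (x \<otimes> inv y))" if "\<phi> \<in> characters F" for \<phi>
  proof -
    have "\<phi> x * cnj (\<phi> y) = \<phi> (x \<otimes> inv y)" if "x \<in> W" "y \<in> W" for x y
    proof -
      have "x \<in> F" "y \<in> F" "inv y \<in> F" using that W subgroup.m_inv_closed[OF F(1)] by auto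
      then show ?thesis
        using char_inv(2)[OF F(1) \<open>\<phi> \<in> characters F\<close>] charactersD(2)[OF \<open>\<phi> \<in> characters F\<close>] by simp
    qed
    then show ?thesis by (simp add: sum_product)
  qed
  have sum_w: "(\<Sum>\<phi>\<in>characters F. (cmod (?w \<phi>))\<^sup>2) = real (card F) * real (card W)"
  proof -
    have "complex_of_real (\<Sum>\<phi>\<in>characters F. (cmod (?w \<phi>))\<^sup>2) = (\<Sum>\<phi>\<in>characters F. ?w \<phi> * cnj (?w \<phi>))"
      unfolding of_real_sum complex_norm_square ..
    also have "\<dots> = (\<Sum>\<phi>\<in>characters F. \<Sum>x\<in>W. \<Sum>y\<in>W. \<phi> (x \<otimes> inv y))"
      using expand by (rule sum.cong[OF refl])
    also have "\<dots> = (\<Sum>x\<in>W. \<Sum>y\<in>W. \<Sum>\<phi>\<in>characters F. \<phi> (x \<otimes> inv y))"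
      by (subst sum.swap) (intro sum.cong refl sum.swap)
    also have "\<dots> = (\<Sum>x\<in>W. \<Sum>y\<in>W. if y = x then of_nat (card F) else 0)"
    proof (intro sum.cong refl)
      fix x y assume "x \<in> W" "y \<in> W"
      then have xy: "x \<in> F" "y \<in> F" "inv y \<in> F" using W subgroup.m_inv_closed[OF F(1)] by auto
      then have "x \<otimes> inv y \<in> F" using subgroup.m_closed[OF F(1)] by blast
      moreover have "x \<otimes> inv y = \<one> \<longleftrightarrow> y = x"
        by (rule mult_inv_eq_one_iff[OF Fc[OF xy(1)] Fc[OF xy(2)]])
      ultimately show "(\<Sum>\<phi>\<in>characters F. \<phi> (x \<otimes> inv y)) = (if y = x then of_nat (card F) else 0)"
        using sum_characters[OF F] by simp
    qed
    also have "\<dots> = of_nat (card F) * of_nat (card W)"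
      using finW by simp
    also have "\<dots> = complex_of_real (real (card F) * real (card W))" by simp
    finally show ?thesis by (simp only: of_real_eq_iff)
  qed
  have main: "(\<Sum>\<phi>\<in>characters F. ?c \<phi> * (?w \<phi> * cnj (?w \<phi>))) = card F * (\<Sum>x\<in>W. \<Sum>y\<in>W. f (x \<otimes> inv y))"
  proof -
    have "(\<Sum>\<phi>\<in>characters F. ?c \<phi> * (?w \<phi> * cnj (?w \<phi>)))
        = (\<Sum>\<phi>\<in>characters F. \<Sum>x\<in>W. \<Sum>y\<in>W. \<Sum>a\<in>F. of_real (f a) * \<phi> ((x \<otimes> inv y) \<otimes> inv a))"
    proof (intro sum.cong refl)
      fix \<phi> assume \<phi>: "\<phi> \<in> characters F"
      have "?c \<phi> * (?w \<phi> * cnj (?w \<phi>)) = (\<Sum>x\<in>W. \<Sum>y\<in>W. ?c \<phi> * \<phi> (x \<otimes> inv y))"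
        using expand[OF \<phi>] by (simp add: sum_distrib_left)
      also have "\<dots> = (\<Sum>x\<in>W. \<Sum>y\<in>W. \<Sum>a\<in>F. of_real (f a) * \<phi> ((x \<otimes> inv y) \<otimes> inv a))"
      proof (intro sum.cong refl)
        fix x y assume "x \<in> W" "y \<in> W"
        then have xy: "x \<otimes> inv y \<in> F"
          using W subgroup.m_inv_closed[OF F(1)] subgroup.m_closed[OF F(1)] by blast
        show "?c \<phi> * \<phi> (x \<otimes> inv y) = (\<Sum>a\<in>F. of_real (f a) * \<phi> ((x \<otimes> inv y) \<otimes> inv a))"
          unfolding sum_distrib_right
          using xy charactersD(2)[OF \<phi>] subgroup.m_inv_closed[OF F(1)] by (intro sum.cong) auto
      qed
      finally show "?c \<phi> * (?w \<phi> * cnj (?w \<phi>)) = (\<Sum>x\<in>W. \<Sum>y\<in>W. \<Sum>a\<in>F. of_real (f a) * \<phi> ((x \<otimes> inv y) \<otimes> inv a))" .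
    qed
    also have "\<dots> = (\<Sum>x\<in>W. \<Sum>y\<in>W. \<Sum>\<phi>\<in>characters F. \<Sum>a\<in>F. of_real (f a) * \<phi> ((x \<otimes> inv y) \<otimes> inv a))"
      by (subst sum.swap, intro sum.cong refl, rule sum.swap)
    also have "\<dots> = (\<Sum>x\<in>W. \<Sum>y\<in>W. of_nat (card F) * of_real (f (x \<otimes> inv y)))"
    proof (intro sum.cong refl)
      fix x y assume "x \<in> W" "y \<in> W"
      then have xy: "x \<otimes> inv y \<in> F"
        using W subgroup.m_inv_closed[OF F(1)] subgroup.m_closed[OF F(1)] by blast
      let ?z = "x \<otimes> inv y"
      have "(\<Sum>\<phi>\<in>characters F. \<Sum>a\<in>F. of_real (f a) * \<phi> (?z \<otimes> inv a))
          = (\<Sum>a\<in>F. of_real (f a) * (\<Sum>\<phi>\<in>characters F. \<phi> (?z \<otimes> inv a)))"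
        by (subst sum.swap) (simp add: sum_distrib_left)
      also have "\<dots> = (\<Sum>a\<in>F. if a = ?z then of_real (f a) * of_nat (card F) else 0)"
      proof (intro sum.cong refl)
        fix a assume a: "a \<in> F"
        then have "?z \<otimes> inv a \<in> F" using xy subgroup.m_inv_closed[OF F(1)] subgroup.m_closed[OF F(1)] by blast
        moreover have "?z \<otimes> inv a = \<one> \<longleftrightarrow> a = ?z"
          by (rule mult_inv_eq_one_iff[OF Fc[OF xy] Fc[OF a]])
        ultimately show "of_real (f a) * (\<Sum>\<phi>\<in>characters F. \<phi> (?z \<otimes> inv a)) = (if a = ?z then of_real (f a) * of_nat (card F) else 0)"
          using sum_characters[OF F] by simp
      qed
      also have "\<dots> = of_nat (card F) * of_real (f ?z)"
        using xy F by simp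
      finally show "(\<Sum>\<phi>\<in>characters F. \<Sum>a\<in>F. of_real (f a) * \<phi> (?z \<otimes> inv a)) = of_nat (card F) * complex_of_real (f ?z)" .
    qed
    finally show ?thesis by (simp add: sum_distrib_left)
  qed
  have ne: "characters F \<noteq> {}" and fin: "finite (characters F)"
    using card_characters[OF F] \<open>card F > 0\<close> finite_characters[OF F] by auto
  define B where "B = Max ((\<lambda>\<phi>. cmod (?c \<phi>)) ` characters F)"
  have B: "cmod (?c \<phi>) \<le> B" if "\<phi> \<in> characters F" for \<phi>
    unfolding B_def using fin that by auto
  have "B \<in> (\<lambda>\<phi>. cmod (?c \<phi>)) ` characters F"
    unfolding B_def using fin ne by (intro Max_in) auto
  then obtain \<phi> where \<phi>: "\<phi> \<in> characters F" "B = cmod (?c \<phi>)" by blast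
  have "card F * (d * (card W)\<^sup>2) \<le> card F * (\<Sum>x\<in>W. \<Sum>y\<in>W. f (x \<otimes> inv y))"
  proof (intro mult_left_mono)
    have "d * (card W)\<^sup>2 = (\<Sum>x\<in>W. \<Sum>y\<in>W. d)" by (simp add: power2_eq_square)
    also have "\<dots> \<le> (\<Sum>x\<in>W. \<Sum>y\<in>W. f (x \<otimes> inv y))" by (intro sum_mono f)
    finally show "d * (card W)\<^sup>2 \<le> (\<Sum>x\<in>W. \<Sum>y\<in>W. f (x \<otimes> inv y))" .
  qed simp
  also have "\<dots> \<le> cmod (complex_of_real (card F * (\<Sum>x\<in>W. \<Sum>y\<in>W. f (x \<otimes> inv y))))"
    by (metis abs_ge_self norm_of_real)
  also have "\<dots> \<le> (\<Sum>\<phi>\<in>characters F. cmod (?c \<phi> * (?w \<phi> * cnj (?w \<phi>))))"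
    unfolding main[symmetric] by (rule norm_sum)
  also have "\<dots> \<le> (\<Sum>\<phi>\<in>characters F. B * (cmod (?w \<phi>))\<^sup>2)"
  proof (rule sum_mono)
    fix \<phi> assume "\<phi> \<in> characters F"
    from mult_right_mono[OF B[OF this], of "(cmod (?w \<phi>))\<^sup>2"]
    show "cmod (?c \<phi> * (?w \<phi> * cnj (?w \<phi>))) \<le> B * (cmod (?w \<phi>))\<^sup>2"
      by (simp only: norm_mult complex_mod_cnj power2_eq_square) simp
  qed
  also have "\<dots> = B * (card F * card W)"
    using sum_w by (simp flip: sum_distrib_left)
  finally have "(card F * card W) * (d * card W) \<le> (card F * card W) * B"
    by (simp add: power2_eq_square mult_ac)
  then have dB: "d * card W \<le> B" using W0 \<open>card F > 0\<close> by simp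
  have "d * card F \<le> d * (k * card W)"
    using k d by (intro mult_left_mono) (auto simp flip: of_nat_mult)
  also have "\<dots> \<le> k * B" using mult_left_mono[OF dB, of k] by (simp add: mult_ac)
  finally show ?thesis using that \<phi> by simp
qed

text \<open>
  The correlation of \<open>\<phi>\<close> with \<open>f\<close> on \<open>F\<close> may be attained on any coset of \<open>F\<close>. This freedom is what makes
  the property pass to smaller subgroups, and thus usable in a compactness argument.
\<close>

definition has_large_average :: "('a \<Rightarrow> real) \<Rightarrow> real \<Rightarrow> 'a set \<Rightarrow> ('a \<Rightarrow> complex) \<Rightarrow> bool" where
  "has_large_average f c F \<phi> \<longleftrightarrow>
     (\<exists>x\<in>carrier G. c * card F \<le> cmod (\<Sum>a\<in>F. of_real (f (x \<otimes> a)) * \<phi> (inv a)))"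

lemma bij_betw_translation:
  assumes "subgroup F G" "a \<in> F"
  shows "bij_betw (\<lambda>b. b \<otimes> a) F F"
proof (rule bij_betwI[where g = "\<lambda>x. x \<otimes> inv a"])
  show "(\<lambda>b. b \<otimes> a) \<in> F \<rightarrow> F" "(\<lambda>b. b \<otimes> inv a) \<in> F \<rightarrow> F"
    using assms by (auto simp: subgroup.m_closed subgroup.m_inv_closed)
  show "x \<otimes> a \<otimes> inv a = x" "x \<otimes> inv a \<otimes> a = x" if "x \<in> F" for x
    using subgroup.mem_carrier[OF assms(1)] that assms by (auto simp: m_assoc)
qed

text \<open>
  The average over \<open>F\<close> at \<open>x\<close> is the mean, twisted by \<open>\<phi>\<close>, of the averages over \<open>E\<close> at the points
  \<open>x \<otimes> b\<close> with \<open>b \<in> F\<close>, and \<open>\<phi>\<close> has modulus 1; so not all of the latter can be small.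
\<close>

lemma has_large_average_subgroup:
  assumes F: "subgroup F G" "finite F" and E: "subgroup E G" "E \<subseteq> F"
    and \<phi>: "\<phi> \<in> characters F" and avg: "has_large_average f c F \<phi>"
  shows "has_large_average f c E \<phi>"
proof (rule ccontr)
  let ?S = "\<lambda>E x. \<Sum>a\<in>E. of_real (f (x \<otimes> a)) * \<phi> (inv a) :: complex"
  note Fc = subgroup.mem_carrier[OF F(1)]
  assume "\<not> has_large_average f c E \<phi>"
  then have small: "cmod (?S E x) < c * card E" if "x \<in> carrier G" for x
    using that unfolding has_large_average_def by force
  obtain x where x: "x \<in> carrier G" "c * card F \<le> cmod (?S F x)"
    using avg unfolding has_large_average_def by blast
  have F0: "card F > 0" using F subgroup.one_closed[OF F(1)] by (auto simp: card_gt_0_iff)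
  have E0: "card E > 0" using F E subgroup.one_closed[OF E(1)] finite_subset by (auto simp: card_gt_0_iff)
  have "(\<Sum>b\<in>F. \<phi> (inv b) * ?S E (x \<otimes> b))
      = (\<Sum>b\<in>F. \<Sum>a\<in>E. of_real (f (x \<otimes> (b \<otimes> a))) * \<phi> (inv (b \<otimes> a)))"
    unfolding sum_distrib_left
  proof (intro sum.cong refl)
    fix b a assume ba: "b \<in> F" "a \<in> E"
    then have "inv b \<in> F" "inv a \<in> F" "b \<in> carrier G" "a \<in> carrier G"
      using E(2) Fc subgroup.m_inv_closed[OF F(1)] by (auto simp: subset_iff)
    then show "\<phi> (inv b) * (of_real (f (x \<otimes> b \<otimes> a)) * \<phi> (inv a)) = of_real (f (x \<otimes> (b \<otimes> a))) * \<phi> (inv (b \<otimes> a))"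
      using x charactersD(2)[OF \<phi>] by (simp add: inv_mult m_assoc)
  qed
  also have "\<dots> = (\<Sum>a\<in>E. \<Sum>b\<in>F. of_real (f (x \<otimes> (b \<otimes> a))) * \<phi> (inv (b \<otimes> a)))"
    by (rule sum.swap)
  also have "\<dots> = (\<Sum>a\<in>E. ?S F x)"
    using E by (intro sum.cong refl sum.reindex_bij_betw[OF bij_betw_translation[OF F(1)]]) auto
  also have "\<dots> = of_nat (card E) * ?S F x" by simp
  finally have eq: "(\<Sum>b\<in>F. \<phi> (inv b) * ?S E (x \<otimes> b)) = of_nat (card E) * ?S F x" .
  have "card E * (c * card F) \<le> card E * cmod (?S F x)" using x(2) by (intro mult_left_mono) auto
  also have "\<dots> = cmod (\<Sum>b\<in>F. \<phi> (inv b) * ?S E (x \<otimes> b))" by (simp add: eq norm_mult)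
  also have "\<dots> \<le> (\<Sum>b\<in>F. cmod (\<phi> (inv b) * ?S E (x \<otimes> b)))" by (rule norm_sum)
  also have "\<dots> = (\<Sum>b\<in>F. cmod (?S E (x \<otimes> b)))"
    using char_root(2)[OF F(1) \<phi>] subgroup.m_inv_closed[OF F(1)] by (intro sum.cong) (auto simp: norm_mult)
  also have "\<dots> < (\<Sum>b\<in>F. c * card E)"
    using F F0 small x Fc by (intro sum_strict_mono) auto
  finally show False by (simp add: mult_ac)
qed

section \<open>Passing to the limit over all finite subgroups\<close>

text \<open>
  A condition on finitely many coordinates with finitely many values is a finite union of cylinders.
\<close>

lemma closedin_finite_coordinates:
  assumes R: "finite R" and F: "finite F" "F \<subseteq> I"
    and dep: "\<And>u v. (\<And>i. i \<in> F \<Longrightarrow> u i = v i) \<Longrightarrow> P u = P v"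
  shows "closedin (product_topology (\<lambda>_. discrete_topology R) I) {u \<in> PiE I (\<lambda>_. R). P u}"
proof -
  let ?X = "product_topology (\<lambda>_. discrete_topology R) I"
  let ?E = "{s \<in> PiE F (\<lambda>_. R). P s}"
  let ?C = "\<lambda>s. {u \<in> PiE I (\<lambda>_. R). \<forall>i\<in>F. u i = s i}"
  have "closedin ?X (?C s)" for s
  proof -
    have "closedin ?X {u \<in> topspace ?X. u i \<in> R \<inter> {s i}}" if "i \<in> F" for i
      using that F by (intro closedin_continuous_map_preimage[of _ "discrete_topology R"] continuous_map_product_projection) auto
    then have "closedin ?X (\<Inter>(insert (topspace ?X) ((\<lambda>i. {u \<in> topspace ?X. u i \<in> R \<inter> {s i}}) ` F)))"
      by (intro closedin_Inter) (blast intro: closedin_topspace)+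
    also have "\<Inter>(insert (topspace ?X) ((\<lambda>i. {u \<in> topspace ?X. u i \<in> R \<inter> {s i}}) ` F)) = ?C s"
      using F by (auto simp: PiE_iff intro: extensional_arb)
    finally show ?thesis .
  qed
  moreover have "{u \<in> PiE I (\<lambda>_. R). P u} = (\<Union>s\<in>?E. ?C s)"
  proof (intro equalityI subsetI)
    fix u assume u: "u \<in> {u \<in> PiE I (\<lambda>_. R). P u}"
    have "P (restrict u F) = P u" by (rule dep) auto
    then have "restrict u F \<in> ?E" using u F by auto
    moreover have "u \<in> ?C (restrict u F)" using u by auto
    ultimately show "u \<in> (\<Union>s\<in>?E. ?C s)" by (rule UN_I[of "restrict u F"])
  next
    fix u assume "u \<in> (\<Union>s\<in>?E. ?C s)"
    then obtain s where "P s" "u \<in> ?C s" by blast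
    then show "u \<in> {u \<in> PiE I (\<lambda>_. R). P u}" using dep[of u s] by auto
  qed
  moreover have "finite ?E" using R F by (intro finite_subset[OF _ finite_PiE[of F "\<lambda>_. R"]]) auto
  ultimately show ?thesis by (auto intro!: closedin_Union)
qed

text \<open>
  For each finite \<open>F\<close>, the functions into the \<open>N\<close>-th roots of unity that restrict to a character of
  \<open>F\<close> with a large average form a closed set in a compact product. These sets have the finite
  intersection property because finitely many finite subgroups lie in a common one and both conditions
  are inherited by subgroups.
\<close>

lemma character_with_large_averages:
  assumes S: "finite S" "S \<subseteq> carrier G"
    and ex: "\<And>F. subgroup F G \<Longrightarrow> finite F \<Longrightarrow> S \<subseteq> F \<Longrightarrow> \<exists>\<phi>\<in>characters F. has_large_average f c F \<phi>"
  obtains \<phi> where "\<phi> \<in> characters (carrier G)"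
    "\<And>F. subgroup F G \<Longrightarrow> finite F \<Longrightarrow> has_large_average f c F \<phi>"
proof -
  define R where "R = {z::complex. z ^ N = 1}"
  have R: "finite R" "R \<noteq> {}" using exponent_pos by (auto simp: R_def intro!: finite_roots_unity exI[of _ 1])
  let ?X = "product_topology (\<lambda>_. discrete_topology R) (carrier G)"
  let ?P = "\<lambda>F \<phi>. restrict \<phi> F \<in> characters F \<and> has_large_average f c F \<phi>"
  let ?C = "\<lambda>F. {\<phi> \<in> PiE (carrier G) (\<lambda>_. R). ?P F \<phi>}"
  let ?U = "?C ` {F. subgroup F G \<and> finite F}"
  have avg_cong: "has_large_average f c F u \<longleftrightarrow> has_large_average f c F v"
    if "subgroup F G" "\<And>i. i \<in> F \<Longrightarrow> u i = v i" for F u v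
  proof -
    have "(\<Sum>a\<in>F. of_real (f (x \<otimes> a)) * u (inv a)) = (\<Sum>a\<in>F. of_real (f (x \<otimes> a)) * v (inv a))" for x
      using that subgroup.m_inv_closed[OF that(1)] by (intro sum.cong) auto
    then show ?thesis unfolding has_large_average_def by simp
  qed
  have compact: "compact_space ?X"
    using R by (simp add: compact_space_product_topology compact_space_discrete_topology)
  have closed: "closedin ?X (?C F)" if F: "subgroup F G" "finite F" for F
  proof (rule closedin_finite_coordinates[OF R(1) F(2) subgroup.subset[OF F(1)]])
    fix u v assume uv: "\<And>i. i \<in> F \<Longrightarrow> u i = (v i :: complex)"
    then have "restrict u F = restrict v F" by auto
    then show "?P F u = ?P F v" using avg_cong[OF F(1) uv] by simp
  qed
  have fip: "\<Inter>(?C ` \<F>) \<noteq> {}" if "finite \<F>" "\<F> \<subseteq> {F. subgroup F G \<and> finite F}" for \<F>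
  proof -
    have "F \<subseteq> carrier G" if "F \<in> \<F>" for F
      using that \<open>\<F> \<subseteq> _\<close> by (intro subgroup.subset) blast
    then have sub: "S \<union> \<Union>\<F> \<subseteq> carrier G" using S(2) by blast
    have fin: "finite (S \<union> \<Union>\<F>)" using that S(1) by auto
    obtain E where E: "subgroup E G" "finite E" "S \<union> \<Union>\<F> \<subseteq> E"
      by (rule finite_subgroup_containing[OF fin sub])
    then obtain \<phi> where \<phi>: "\<phi> \<in> characters E" "has_large_average f c E \<phi>"
      using ex[of E] by auto
    \<comment> \<open>The value 1 outside \<open>E\<close> keeps \<open>\<psi>\<close> within the \<open>N\<close>-th roots of unity.\<close>
    define \<psi> where "\<psi> = (\<lambda>x\<in>carrier G. if x \<in> E then \<phi> x else 1)"
    have "\<psi> \<in> ?C F" if "F \<in> \<F>" for F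
    proof -
      have F: "subgroup F G" "finite F" "F \<subseteq> E" using that E \<open>\<F> \<subseteq> _\<close> by auto
      have eq: "\<psi> x = \<phi> x" if "x \<in> F" for x
        using that F E subgroup.mem_carrier[OF F(1)] by (auto simp: \<psi>_def)
      then have "restrict \<psi> F = restrict \<phi> F" by auto
      moreover have "\<psi> \<in> PiE (carrier G) (\<lambda>_. R)"
        using char_root(1)[OF E(1) \<phi>(1)] by (auto simp: \<psi>_def R_def)
      ultimately show ?thesis
        using char_restrict[OF \<phi>(1) F(3,1)] has_large_average_subgroup[OF E(1,2) F(1,3) \<phi>]
          avg_cong[OF F(1) eq] by auto
    qed
    then show ?thesis by blast
  qed
  have "\<Inter>?U \<noteq> {}"
  proof -
    have "\<forall>C\<in>?U. closedin ?X C" using closed by blast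
    moreover have "\<forall>\<E>. finite \<E> \<and> \<E> \<subseteq> ?U \<longrightarrow> \<Inter>\<E> \<noteq> {}"
      unfolding all_finite_subset_image using fip by simp
    ultimately show ?thesis using compact[unfolded compact_space_fip, rule_format, of ?U] by simp
  qed
  then obtain \<phi> where \<phi>: "\<And>F. subgroup F G \<Longrightarrow> finite F \<Longrightarrow> \<phi> \<in> ?C F" by blast
  have ext: "\<phi> \<in> extensional (carrier G)" using \<phi>[OF triv_subgroup] by (auto simp: PiE_iff)
  have "\<phi> \<in> characters (carrier G)"
    unfolding characters_def
  proof (intro CollectI conjI ballI ext)
    fix x y assume xy: "x \<in> carrier G" "y \<in> carrier G"
    then obtain F where F: "subgroup F G" "finite F" "{x, y} \<subseteq> F"
      using finite_subgroup_containing[of "{x, y}"] by blast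
    then have r: "restrict \<phi> F \<in> characters F" using \<phi> by auto
    have "x \<in> F" "y \<in> F" "x \<otimes> y \<in> F" using F subgroup.m_closed by auto
    then show "\<phi> (x \<otimes> y) = \<phi> x * \<phi> y" using charactersD(2)[OF r, of x y] by simp
  next
    fix x assume "x \<in> carrier G"
    then have "\<phi> x ^ N = 1" using \<phi>[OF triv_subgroup] by (auto simp: PiE_iff R_def)
    then show "\<phi> x \<noteq> 0" using exponent_pos by (auto simp: power_0_left)
  qed
  then show ?thesis using that \<phi> by blast
qed

end

section \<open>Continuous characters separate points from closed subgroups\<close>

locale compact_bounded_group = topological_group G T + bounded_comm_group G N
  for G (structure) and T and N +
  assumes compact: "compact_space T" and Hausdorff: "Hausdorff_space T"
begin

definition dual :: "('a \<Rightarrow> complex) set" where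
  "dual = {\<phi> \<in> characters (carrier G). continuous_map T euclidean \<phi>}"

text \<open>
  Uniform continuity with respect to translations. Unlike continuity it is visibly preserved by the
  suprema in \<open>uniform_SUP\<close>, and it is all that the construction of a continuous character uses.
\<close>

definition uniform :: "('a \<Rightarrow> real) \<Rightarrow> bool" where
  "uniform f \<longleftrightarrow> (\<forall>e>0. \<exists>V. openin T V \<and> \<one> \<in> V \<and>
     (\<forall>x\<in>carrier G. \<forall>y\<in>V. \<bar>f (x \<otimes> y) - f x\<bar> < e))"

lemma uniformE:
  assumes "uniform f" "e > 0"
  obtains V where "openin T V" "\<one> \<in> V"
    "\<forall>x\<in>carrier G. \<forall>y\<in>V. \<bar>f (x \<otimes> y) - f x\<bar> < e" "V \<subseteq> carrier G"
proof -
  obtain V where V: "openin T V" "\<one> \<in> V" "\<forall>x\<in>carrier G. \<forall>y\<in>V. \<bar>f (x \<otimes> y) - f x\<bar> < e"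
    using assms unfolding uniform_def by blast
  moreover have "V \<subseteq> carrier G" using openin_subset[OF V(1)] topspace_eq_carrier by simp
  ultimately show ?thesis using that by blast
qed

lemma continuous_translation:
  assumes "x \<in> carrier G"
  shows "continuous_map T T (\<lambda>z. x \<otimes> z)"
proof -
  have "continuous_map T (prod_topology T T) (\<lambda>z. (x, z))"
    using assms topspace_eq_carrier by (intro continuous_map_pairedI) auto
  from continuous_map_compose[OF this continuous_mult] show ?thesis by (simp add: o_def)
qed

lemma openin_translation:
  assumes "x \<in> carrier G" "openin T V"
  shows "openin T {z \<in> carrier G. x \<otimes> z \<in> V}"
  using openin_continuous_map_preimage[OF continuous_translation assms(2)] assms topspace_eq_carrier by simp

lemma closedin_translation:
  assumes "x \<in> carrier G" "closedin T V"
  shows "closedin T {z \<in> carrier G. x \<otimes> z \<in> V}"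
  using closedin_continuous_map_preimage[OF continuous_translation assms(2)] assms topspace_eq_carrier by simp

text \<open>
  The set of pairs \<open>(x, y)\<close> with \<open>\<bar>u (x \<otimes> y) - u x\<bar> < e\<close> is open and contains \<open>carrier G \<times> {\<one>}\<close>; the tube
  lemma applies because the first factor is compact.
\<close>

lemma continuous_imp_uniform:
  assumes u: "continuous_map T euclideanreal u"
  shows "uniform u"
  unfolding uniform_def
proof (intro allI impI)
  fix e :: real assume "e > 0"
  let ?g = "\<lambda>p. u (case p of (x, y) \<Rightarrow> x \<otimes> y) - u (fst p)"
  have "continuous_map (prod_topology T T) euclideanreal ?g"
    using continuous_map_compose[OF continuous_mult u] continuous_map_compose[OF continuous_map_fst u]
    by (intro continuous_map_diff) (auto simp: o_def)
  then have W: "openin (prod_topology T T) {p \<in> topspace (prod_topology T T). ?g p \<in> ball 0 e}"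
    by (rule openin_continuous_map_preimage) simp
  have "topspace T \<times> {\<one>} \<subseteq> {p \<in> topspace (prod_topology T T). ?g p \<in> ball 0 e}"
    using \<open>e > 0\<close> topspace_eq_carrier by auto
  from tube_lemma_left[OF W _ _ this] compact
  obtain U V where UV: "openin T V" "topspace T \<subseteq> U" "\<one> \<in> V"
    "U \<times> V \<subseteq> {p \<in> topspace (prod_topology T T). ?g p \<in> ball 0 e}"
    unfolding compact_space_def using topspace_eq_carrier by auto
  have "\<bar>u (x \<otimes> y) - u x\<bar> < e" if "x \<in> carrier G" "y \<in> V" for x y
  proof -
    have "(x, y) \<in> U \<times> V" using that UV(2) topspace_eq_carrier by blast
    then have "?g (x, y) \<in> ball 0 e" using UV(4) by blast
    then show ?thesis by (simp add: dist_real_def)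
  qed
  then show "\<exists>V. openin T V \<and> \<one> \<in> V \<and> (\<forall>x\<in>carrier G. \<forall>y\<in>V. \<bar>u (x \<otimes> y) - u x\<bar> < e)"
    using UV by blast
qed

text \<open>
  Taking suprema over cosets of \<open>K\<close> makes a function invariant under \<open>K\<close>; it takes the place of passing
  to the quotient group.
\<close>

lemma uniform_SUP:
  assumes u: "uniform u" "\<And>x. x \<in> carrier G \<Longrightarrow> u x \<le> 1" and K: "subgroup K G"
  shows "uniform (\<lambda>x. SUP k\<in>K. u (x \<otimes> k))"
  unfolding uniform_def
proof (intro allI impI)
  fix e :: real assume e: "e > 0"
  note Kc = subgroup.mem_carrier[OF K]
  let ?h = "\<lambda>x. SUP k\<in>K. u (x \<otimes> k)"
  obtain V where V: "openin T V" "\<one> \<in> V" "\<forall>x\<in>carrier G. \<forall>y\<in>V. \<bar>u (x \<otimes> y) - u x\<bar> < e / 2" and VG: "V \<subseteq> carrier G"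
    by (rule uniformE[OF u(1) half_gt_zero[OF e]])
  have ne: "K \<noteq> {}" using subgroup.one_closed[OF K] by blast
  have upper: "u (x \<otimes> k) \<le> ?h x" if "x \<in> carrier G" "k \<in> K" for x k
    using that u(2) Kc by (intro cSUP_upper bdd_aboveI2[of _ _ 1]) auto
  have "\<bar>?h (x \<otimes> y) - ?h x\<bar> < e" if xy: "x \<in> carrier G" "y \<in> V" for x y
  proof -
    have yG: "y \<in> carrier G" using xy VG by blast
    have close: "\<bar>u (x \<otimes> y \<otimes> k) - u (x \<otimes> k)\<bar> < e / 2" if "k \<in> K" for k
    proof -
      have "x \<otimes> y \<otimes> k = x \<otimes> k \<otimes> y" using that xy yG Kc by (simp add: m_ac)
      then show ?thesis using V(3)[rule_format, of "x \<otimes> k" y] xy that Kc by simp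
    qed
    have "?h (x \<otimes> y) \<le> ?h x + e / 2"
    proof (rule cSUP_least[OF ne])
      fix k assume "k \<in> K"
      then show "u (x \<otimes> y \<otimes> k) \<le> ?h x + e / 2" using close[of k] upper[of x k] xy by linarith
    qed
    moreover have "?h x \<le> ?h (x \<otimes> y) + e / 2"
    proof (rule cSUP_least[OF ne])
      fix k assume "k \<in> K"
      then show "u (x \<otimes> k) \<le> ?h (x \<otimes> y) + e / 2" using close[of k] upper[of "x \<otimes> y" k] xy yG m_closed[of x y] by linarith
    qed
    ultimately show ?thesis using e by linarith
  qed
  then show "\<exists>V. openin T V \<and> \<one> \<in> V \<and> (\<forall>x\<in>carrier G. \<forall>y\<in>V. \<bar>?h (x \<otimes> y) - ?h x\<bar> < e)"
    using V by blast
qed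

lemma uniform_difference:
  assumes u: "uniform u" and a: "a \<in> carrier G"
  shows "uniform (\<lambda>x. u x - u (x \<otimes> a))"
  unfolding uniform_def
proof (intro allI impI)
  fix e :: real assume e: "e > 0"
  obtain V where V: "openin T V" "\<one> \<in> V" "\<forall>x\<in>carrier G. \<forall>y\<in>V. \<bar>u (x \<otimes> y) - u x\<bar> < e / 2" and VG: "V \<subseteq> carrier G"
    by (rule uniformE[OF u half_gt_zero[OF e]])
  have "\<bar>(u (x \<otimes> y) - u (x \<otimes> y \<otimes> a)) - (u x - u (x \<otimes> a))\<bar> < e" if xy: "x \<in> carrier G" "y \<in> V" for x y
  proof -
    have "x \<otimes> y \<otimes> a = x \<otimes> a \<otimes> y" using xy VG a by (simp add: m_ac subset_iff)
    then show ?thesis using V(3)[rule_format, of "x \<otimes> a" y] V(3)[rule_format, of x y] xy a m_closed[of x a] by (simp; linarith)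
  qed
  then show "\<exists>V. openin T V \<and> \<one> \<in> V \<and> (\<forall>x\<in>carrier G. \<forall>y\<in>V. \<bar>(u (x \<otimes> y) - u (x \<otimes> y \<otimes> a)) - (u x - u (x \<otimes> a))\<bar> < e)"
    using V by blast
qed

text \<open>
  Averaging over \<open>F\<close> against \<open>\<phi>\<close> projects \<open>f\<close> onto a function on which translation by \<open>y \<in> F\<close> acts
  as multiplication by \<open>\<phi> y\<close>; substitute \<open>a \<otimes> y\<close> for \<open>a\<close> in the sum.
\<close>

lemma average_shift:
  assumes F: "subgroup F G" "finite F" and \<phi>: "\<phi> \<in> characters (carrier G)"
    and y: "y \<in> F" and p: "p \<in> carrier G"
  shows "(\<Sum>a\<in>F. of_real (f (p \<otimes> y \<otimes> a)) * \<phi> (inv a)) = \<phi> y * (\<Sum>a\<in>F. of_real (f (p \<otimes> a)) * \<phi> (inv a))"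
proof -
  note Fc = subgroup.mem_carrier[OF F(1)]
  have "\<phi> y * (\<Sum>a\<in>F. of_real (f (p \<otimes> a)) * \<phi> (inv a))
      = \<phi> y * (\<Sum>a\<in>F. of_real (f (p \<otimes> (a \<otimes> y))) * \<phi> (inv (a \<otimes> y)))"
    by (rule arg_cong[where f = "\<lambda>z. \<phi> y * z"], rule sum.reindex_bij_betw[OF bij_betw_translation[OF F(1) y], symmetric])
  also have "\<dots> = (\<Sum>a\<in>F. of_real (f (p \<otimes> y \<otimes> a)) * \<phi> (inv a))"
    unfolding sum_distrib_left
  proof (intro sum.cong refl)
    fix a assume a: "a \<in> F"
    have G: "a \<in> carrier G" "y \<in> carrier G" "inv a \<in> carrier G" "inv y \<in> carrier G" using a y Fc by auto
    have "\<phi> y * \<phi> (inv (a \<otimes> y)) = \<phi> (y \<otimes> inv (a \<otimes> y))"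
      using charactersD(2)[OF \<phi>] G by simp
    also have "y \<otimes> inv (a \<otimes> y) = inv a" using G by (simp add: inv_mult m_lcomm[of y])
    finally have "\<phi> y * \<phi> (inv (a \<otimes> y)) = \<phi> (inv a)" .
    moreover have "p \<otimes> (a \<otimes> y) = p \<otimes> y \<otimes> a" using G p by (simp add: m_ac)
    ultimately show "\<phi> y * (of_real (f (p \<otimes> (a \<otimes> y))) * \<phi> (inv (a \<otimes> y))) = of_real (f (p \<otimes> y \<otimes> a)) * \<phi> (inv a)"
      by (simp add: algebra_simps)
  qed
  finally show ?thesis ..
qed

text \<open>
  Let \<open>y\<close> be close to \<open>\<one>\<close>, choose a finite \<open>F\<close> that contains \<open>y\<close> and a point \<open>p\<close> where the average is
  large. Moving from \<open>p\<close> to \<open>p \<otimes> y\<close> multiplies the average by \<open>\<phi> y\<close> but changes it only slightly, as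
  \<open>f\<close> is uniformly continuous. Hence \<open>\<phi> y\<close> is close to 1.
\<close>

lemma dual_if_large_averages:
  assumes f: "uniform f" and \<phi>: "\<phi> \<in> characters (carrier G)" and c: "c > 0"
    and avg: "\<And>F. subgroup F G \<Longrightarrow> finite F \<Longrightarrow> has_large_average f c F \<phi>"
  shows "\<phi> \<in> dual"
proof -
  have "\<exists>U. openin T U \<and> x \<in> U \<and> (\<forall>z\<in>U. \<phi> z \<in> ball (\<phi> x) e)" if x: "x \<in> carrier G" and e: "e > 0" for x e
  proof -
    have "e / 2 * c > 0" using e c by simp
    obtain V where V: "openin T V" "\<one> \<in> V" "\<forall>x\<in>carrier G. \<forall>y\<in>V. \<bar>f (x \<otimes> y) - f x\<bar> < e / 2 * c" and VG: "V \<subseteq> carrier G"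
    by (rule uniformE[OF f \<open>e / 2 * c > 0\<close>])
    have near: "cmod (\<phi> y - 1) \<le> e / 2" if y: "y \<in> V" for y
    proof -
      have yG: "y \<in> carrier G" using y VG by blast
      obtain F where F: "subgroup F G" "finite F" "{y} \<subseteq> F"
        using finite_subgroup_containing[of "{y}"] yG by blast
      note Fc = subgroup.mem_carrier[OF F(1)]
      have F0: "card F > 0" using F by (auto simp: card_gt_0_iff)
      let ?S = "\<lambda>p. \<Sum>a\<in>F. of_real (f (p \<otimes> a)) * \<phi> (inv a) :: complex"
      obtain p where p: "p \<in> carrier G" "c * card F \<le> cmod (?S p)"
        using avg[OF F(1,2)] unfolding has_large_average_def by blast
      have "(\<phi> y - 1) * ?S p = ?S (p \<otimes> y) - ?S p"
        using average_shift[OF F(1,2) \<phi> _ p(1), of y f] F(3) by (simp add: algebra_simps)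
      also have "\<dots> = (\<Sum>a\<in>F. of_real (f (p \<otimes> y \<otimes> a) - f (p \<otimes> a)) * \<phi> (inv a))"
        by (simp add: sum_subtractf algebra_simps)
      finally have "cmod (\<phi> y - 1) * cmod (?S p) = cmod (\<Sum>a\<in>F. of_real (f (p \<otimes> y \<otimes> a) - f (p \<otimes> a)) * \<phi> (inv a))"
        by (metis norm_mult)
      also have "\<dots> \<le> (\<Sum>a\<in>F. e / 2 * c)"
      proof (rule sum_norm_le)
        fix a assume "a \<in> F"
        then have a: "a \<in> carrier G" "inv a \<in> carrier G" using Fc by auto
        have "cmod (\<phi> (inv a)) = 1" using char_root(2)[OF subgroup_self \<phi> a(2)] .
        moreover have "p \<otimes> y \<otimes> a = p \<otimes> a \<otimes> y" using a p yG by (simp add: m_ac)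
        ultimately show "cmod (of_real (f (p \<otimes> y \<otimes> a) - f (p \<otimes> a)) * \<phi> (inv a)) \<le> e / 2 * c"
          using V(3)[rule_format, of "p \<otimes> a" y] p a y by (simp add: norm_mult flip: of_real_diff)
      qed
      finally have "cmod (\<phi> y - 1) * cmod (?S p) \<le> e / 2 * (c * card F)" by (simp add: mult_ac)
      moreover have "cmod (\<phi> y - 1) * (c * card F) \<le> cmod (\<phi> y - 1) * cmod (?S p)"
        using p(2) by (intro mult_left_mono) auto
      ultimately have "cmod (\<phi> y - 1) * (c * card F) \<le> e / 2 * (c * card F)" by linarith
      moreover have "c * card F > 0" using c F0 by simp
      ultimately show ?thesis using mult_right_le_imp_le by blast
    qed
    let ?U = "{z \<in> carrier G. inv x \<otimes> z \<in> V}"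
    have "\<phi> z \<in> ball (\<phi> x) e" if "z \<in> ?U" for z
    proof -
      have z: "z \<in> carrier G" "inv x \<otimes> z \<in> V" using that by auto
      have "z = x \<otimes> (inv x \<otimes> z)" using z x by (simp flip: m_assoc)
      then have "\<phi> z = \<phi> x * \<phi> (inv x \<otimes> z)" using charactersD(2)[OF \<phi>] x z by (metis inv_closed m_closed)
      then have "\<phi> z - \<phi> x = \<phi> x * (\<phi> (inv x \<otimes> z) - 1)" by (simp add: algebra_simps)
      then have "cmod (\<phi> z - \<phi> x) = cmod (\<phi> (inv x \<otimes> z) - 1)"
        using char_root(2)[OF subgroup_self \<phi> x] by (simp add: norm_mult)
      also have "\<dots> < e" using near[OF z(2)] e by linarith
      finally show ?thesis by (simp add: dist_norm norm_minus_commute)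
    qed
    moreover have "openin T ?U" using openin_translation x V(1) by blast
    moreover have "x \<in> ?U" using x V(2) by simp
    ultimately show ?thesis by blast
  qed
  then have "continuous_map T euclidean \<phi>"
    unfolding Met_TC.continuous_map_to_metric[of T \<phi>, unfolded mtopology_is_euclidean mball_eq_ball]
    using topspace_eq_carrier by auto
  then show ?thesis using \<phi> unfolding dual_def by blast
qed

text \<open>
  Near \<open>\<one>\<close> the values \<open>f (x \<otimes> inv y)\<close> exceed \<open>1 / 2\<close>; let \<open>V\<close> be such a neighbourhood. If the translates
  of \<open>V\<close> by a finite set \<open>S\<close> cover the group, then \<open>V \<inter> F\<close> has density at least \<open>1 / card S\<close> in every
  finite subgroup \<open>F\<close> that contains \<open>S\<close>, so the Fourier coefficients are bounded below uniformly in \<open>F\<close>.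
\<close>

lemma ex_dual_large_averages:
  assumes f: "uniform f" and f1: "f \<one> = 1"
  obtains \<phi> c where "\<phi> \<in> dual" "c > 0"
    "\<And>F. subgroup F G \<Longrightarrow> finite F \<Longrightarrow> has_large_average f c F \<phi>"
proof -
  obtain V where V: "openin T V" "\<one> \<in> V" "\<forall>x\<in>carrier G. \<forall>y\<in>V. \<bar>f (x \<otimes> y) - f x\<bar> < 1 / 4" and VG: "V \<subseteq> carrier G"
    by (rule uniformE[OF f, of "1 / 4"]) simp
  let ?U = "\<lambda>s. {z \<in> carrier G. inv s \<otimes> z \<in> V}"
  have "\<forall>U\<in>?U ` carrier G. openin T U" using openin_translation V(1) by auto
  moreover have "topspace T \<subseteq> \<Union>(?U ` carrier G)" using V(2) topspace_eq_carrier by auto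
  ultimately obtain \<F> where \<F>: "finite \<F>" "\<F> \<subseteq> ?U ` carrier G" "topspace T \<subseteq> \<Union>\<F>"
    using compact unfolding compact_space_alt by meson
  then obtain S where S: "finite S" "S \<subseteq> carrier G" "\<F> = ?U ` S"
    using finite_subset_image[OF \<F>(1,2)] by blast
  have "S \<noteq> {}" using S \<F> topspace_eq_carrier by auto
  then have k: "card S > 0" using S by (auto simp: card_gt_0_iff)
  let ?c = "1 / (2 * card S)"
  have ex: "\<exists>\<phi>\<in>characters F. has_large_average f ?c F \<phi>" if F: "subgroup F G" "finite F" "S \<subseteq> F" for F
  proof -
    note Fc = subgroup.mem_carrier[OF F(1)]
    let ?W = "V \<inter> F"
    have half: "1 / 2 \<le> f (x \<otimes> inv y)" if "x \<in> ?W" "y \<in> ?W" for x y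
    proof -
      have G: "x \<in> carrier G" "y \<in> carrier G" "x \<in> V" "y \<in> V" using that VG by auto
      then have "x \<otimes> inv y \<otimes> y = x" by (simp add: m_assoc)
      then show ?thesis using V(3)[rule_format, of "x \<otimes> inv y" y] V(3)[rule_format, of \<one> x] G f1 by (simp add: abs_real_def split: if_splits)
    qed
    have "F \<subseteq> (\<lambda>(s, w). s \<otimes> w) ` (S \<times> ?W)"
    proof
      fix x assume x: "x \<in> F"
      then obtain s where s: "s \<in> S" "inv s \<otimes> x \<in> V" using \<F>(3) S(3) Fc[OF x] topspace_eq_carrier by auto
      have "s \<in> F" using s F by blast
      then have "inv s \<otimes> x \<in> F" "s \<otimes> (inv s \<otimes> x) = x"
        using x subgroup.m_inv_closed[OF F(1)] subgroup.m_closed[OF F(1)] Fc by (auto simp flip: m_assoc)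
      then show "x \<in> (\<lambda>(s, w). s \<otimes> w) ` (S \<times> ?W)" using s by (intro image_eqI[of _ _ "(s, inv s \<otimes> x)"]) auto
    qed
    then have "card F \<le> card (S \<times> ?W)" using S F by (intro surj_card_le) auto
    then have "card F \<le> card S * card ?W" by (simp add: card_cartesian_product)
    then obtain \<phi> where \<phi>: "\<phi> \<in> characters F" "1 / 2 * card F \<le> card S * cmod (\<Sum>a\<in>F. of_real (f a) * \<phi> (inv a))"
      using large_fourier_coefficient[where f = f and d = "1 / 2" and k = "card S", OF F(1,2) Int_lower2[of V F] half] by auto
    have "(\<Sum>a\<in>F. of_real (f (\<one> \<otimes> a)) * \<phi> (inv a)) = (\<Sum>a\<in>F. of_real (f a) * \<phi> (inv a))"
      using Fc by (intro sum.cong) auto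
    then have "?c * card F \<le> cmod (\<Sum>a\<in>F. of_real (f (\<one> \<otimes> a)) * \<phi> (inv a))"
      using \<phi>(2) k by (simp add: field_simps)
    then show ?thesis using \<phi>(1) unfolding has_large_average_def by blast
  qed
  obtain \<phi> where \<phi>: "\<phi> \<in> characters (carrier G)"
    "\<And>F. subgroup F G \<Longrightarrow> finite F \<Longrightarrow> has_large_average f ?c F \<phi>"
    using character_with_large_averages[OF S(1,2) ex] by blast
  have "?c > 0" using k by simp
  then show ?thesis using that[OF dual_if_large_averages[OF f \<phi>(1) _ \<phi>(2)]] \<phi>(2) by blast
qed

text \<open>
  Urysohn's lemma gives \<open>u\<close> with \<open>u \<one> = 1\<close> that vanishes on the coset \<open>L\<close> of \<open>x\<close>. Its supremum \<open>h\<close> over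
  cosets of \<open>K\<close> is \<open>K\<close>-invariant with \<open>h \<one> = 1\<close> and \<open>h x = 0\<close>. Apply the construction to
  \<open>f z = h z - h (z \<otimes> x)\<close>. Invariance of \<open>f\<close> under \<open>K\<close> makes \<open>\<phi>\<close> trivial on \<open>K\<close>, since otherwise all
  averages of \<open>f\<close> against \<open>\<phi>\<close> would vanish; and if \<open>\<phi> x = 1\<close>, the two terms of \<open>f\<close> would have the same
  averages and cancel.
\<close>

theorem dual_separates_closed_subgroup:
  assumes K: "subgroup K G" "closedin T K" and x: "x \<in> carrier G" "x \<notin> K"
  obtains \<phi> where "\<phi> \<in> dual" "\<And>k. k \<in> K \<Longrightarrow> \<phi> k = 1" "\<phi> x \<noteq> 1"
proof -
  note Kc = subgroup.mem_carrier[OF K(1)]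
  let ?L = "{z \<in> carrier G. inv x \<otimes> z \<in> K}"
  have "closedin T ?L" using closedin_translation K x by blast
  moreover have "closedin T {\<one>}"
    using Hausdorff topspace_eq_carrier by (simp add: closedin_Hausdorff_singleton)
  \<comment> \<open>Otherwise the inverse of \<open>x\<close>, and with it \<open>x\<close>, would lie in \<open>K\<close>.\<close>
  moreover have "\<one> \<notin> ?L" 
    using x subgroup.m_inv_closed[OF K(1), of "inv x"] by auto
  moreover have "normal_space T" using compact Hausdorff compact_Hausdorff_or_regular_imp_normal_space by blast
  ultimately obtain u :: "'a \<Rightarrow> real" where u: "continuous_map T (top_of_set {0..1}) u" "u ` ?L \<subseteq> {0}" "u ` {\<one>} \<subseteq> {1}"
    using Urysohn_lemma[of T ?L "{\<one>}" 0 1] by (auto simp: disjnt_def)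
  have u01: "0 \<le> u z \<and> u z \<le> 1" if "z \<in> carrier G" for z
    using u(1) that topspace_eq_carrier by (auto simp: continuous_map_in_subtopology image_subset_iff)
  have uunif: "uniform u" using u(1) continuous_imp_uniform continuous_map_in_subtopology by blast
  let ?h = "\<lambda>z. SUP k\<in>K. u (z \<otimes> k)"
  have h: "uniform ?h" using uniform_SUP[OF uunif _ K(1)] u01 by blast
  have hK: "?h (z \<otimes> b) = ?h z" if "z \<in> carrier G" "b \<in> K" for z b
  proof -
    have bij: "bij_betw (\<lambda>k. k \<otimes> b) K K" using bij_betw_translation[OF K(1) that(2)] .
    have "(\<lambda>k. u (z \<otimes> b \<otimes> k)) ` K = (\<lambda>k. u (z \<otimes> k)) ` ((\<lambda>k. k \<otimes> b) ` K)"
      unfolding image_image using that Kc by (intro image_cong refl) (simp add: m_ac)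
    then show ?thesis using bij by (simp add: bij_betw_def)
  qed
  have h1: "?h \<one> = 1"
  proof (rule antisym)
    show "?h \<one> \<le> 1" using u01 Kc subgroup.one_closed[OF K(1)] by (intro cSUP_least) auto
    have "u (\<one> \<otimes> \<one>) \<le> ?h \<one>"
      using u01 Kc subgroup.one_closed[OF K(1)] by (intro cSUP_upper bdd_aboveI2[of _ _ 1]) auto
    then show "1 \<le> ?h \<one>" using u(3) by simp
  qed
  have hx: "?h x = 0"
  proof -
    have "x \<otimes> k \<in> ?L" if "k \<in> K" for k using that x Kc by (simp flip: m_assoc)
    then have "u (x \<otimes> k) = 0" if "k \<in> K" for k using u(2) that by blast
    then have "?h x = (SUP k\<in>K. 0)" by (intro SUP_cong) auto
    moreover have "K \<noteq> {}" using subgroup.one_closed[OF K(1)] by blast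
    ultimately show ?thesis by simp
  qed
  define f where "f = (\<lambda>z. ?h z - ?h (z \<otimes> x))"
  have "uniform f" unfolding f_def by (rule uniform_difference[OF h x(1)])
  moreover have "f \<one> = 1" unfolding f_def using h1 hx x by simp
  ultimately obtain \<phi> c where \<phi>: "\<phi> \<in> dual" "c > 0"
    "\<And>F. subgroup F G \<Longrightarrow> finite F \<Longrightarrow> has_large_average f c F \<phi>"
    using ex_dual_large_averages by blast
  then have \<phi>c: "\<phi> \<in> characters (carrier G)" unfolding dual_def by blast
  have nz: "\<exists>F p. subgroup F G \<and> finite F \<and> y \<in> F \<and> p \<in> carrier G \<and> (\<Sum>a\<in>F. of_real (f (p \<otimes> a)) * \<phi> (inv a)) \<noteq> 0"
    if "y \<in> carrier G" for y
  proof -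
    obtain F where F: "subgroup F G" "finite F" "{y} \<subseteq> F"
      using finite_subgroup_containing[of "{y}"] \<open>y \<in> carrier G\<close> by blast
    then obtain p where p: "p \<in> carrier G" "c * card F \<le> cmod (\<Sum>a\<in>F. of_real (f (p \<otimes> a)) * \<phi> (inv a))"
      using \<phi>(3) unfolding has_large_average_def by blast
    have "card F > 0" using F by (auto simp: card_gt_0_iff)
    then have "c * card F > 0" using \<phi>(2) by simp
    then show ?thesis using p F by (intro exI[of _ F] exI[of _ p]) auto
  qed
  have "\<phi> b = 1" if b: "b \<in> K" for b
  proof -
    obtain F p where F: "subgroup F G" "finite F" "b \<in> F" and p: "p \<in> carrier G"
      and nz: "(\<Sum>a\<in>F. of_real (f (p \<otimes> a)) * \<phi> (inv a)) \<noteq> 0" using nz[OF Kc[OF b]] by blast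
    have "(\<Sum>a\<in>F. of_real (f (p \<otimes> b \<otimes> a)) * \<phi> (inv a)) = (\<Sum>a\<in>F. of_real (f (p \<otimes> a)) * \<phi> (inv a))"
    proof (intro sum.cong refl)
      fix a assume "a \<in> F"
      then have a: "a \<in> carrier G" using subgroup.mem_carrier[OF F(1)] by blast
      have "p \<otimes> b \<otimes> a = p \<otimes> a \<otimes> b" "p \<otimes> b \<otimes> a \<otimes> x = p \<otimes> a \<otimes> x \<otimes> b"
        using a p x Kc[OF b] by (simp_all add: m_ac)
      then have "f (p \<otimes> b \<otimes> a) = f (p \<otimes> a)" unfolding f_def using hK[OF _ b] a p x by simp
      then show "of_real (f (p \<otimes> b \<otimes> a)) * \<phi> (inv a) = of_real (f (p \<otimes> a)) * \<phi> (inv a)" by simp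
    qed
    then show ?thesis using average_shift[OF F(1,2) \<phi>c F(3) p, of f] nz by simp
  qed
  moreover have "\<phi> x \<noteq> 1"
  proof
    assume 1: "\<phi> x = 1"
    obtain F p where F: "subgroup F G" "finite F" "x \<in> F" and p: "p \<in> carrier G"
      and nz: "(\<Sum>a\<in>F. of_real (f (p \<otimes> a)) * \<phi> (inv a)) \<noteq> 0" using nz[OF x(1)] by blast
    have "(\<Sum>a\<in>F. of_real (f (p \<otimes> a)) * \<phi> (inv a))
        = (\<Sum>a\<in>F. of_real (?h (p \<otimes> a)) * \<phi> (inv a)) - (\<Sum>a\<in>F. of_real (?h (p \<otimes> x \<otimes> a)) * \<phi> (inv a))"
      unfolding sum_subtractf[symmetric]
    proof (intro sum.cong refl)
      fix a assume "a \<in> F"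
      then have "a \<in> carrier G" using subgroup.mem_carrier[OF F(1)] by blast
      then have "p \<otimes> x \<otimes> a = p \<otimes> a \<otimes> x" using p x by (simp add: m_ac)
      then show "of_real (f (p \<otimes> a)) * \<phi> (inv a) = of_real (?h (p \<otimes> a)) * \<phi> (inv a) - of_real (?h (p \<otimes> x \<otimes> a)) * \<phi> (inv a)"
        unfolding f_def by (simp add: algebra_simps)
    qed
    also have "\<dots> = 0" using average_shift[OF F(1,2) \<phi>c F(3) p, of ?h] 1 by simp
    finally show False using nz by simp
  qed
  ultimately show ?thesis using that \<phi>(1) by blast
qed

end

section \<open>The dual group and its torsion\<close>

lemma prime_root_of_unity_generates:
  fixes z w :: complex and p :: nat
  assumes p: "prime p" and z: "z ^ p = 1" "z \<noteq> 1" and w: "w ^ p = 1"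
  obtains k where "z ^ k = w"
proof -
  have z0: "z \<noteq> 0" using z prime_gt_0_nat[OF p] by (auto simp: power_0_left)
  have neq: "z ^ i \<noteq> z ^ j" if "i < j" "j < p" for i j
  proof
    assume "z ^ i = z ^ j"
    also have "z ^ j = z ^ i * z ^ (j - i)" using that by (simp flip: power_add)
    finally have 1: "z ^ (j - i) = 1" using z0 by simp
    have "\<not> p dvd (j - i)" using that by (auto dest: dvd_imp_le)
    then have "coprime (j - i) p" using p by (metis coprime_commute prime_imp_coprime)
    then obtain x y where "(j - i) * x = p * y + 1"
      using coprime_bezout_strong[of "j - i" p] prime_gt_1_nat[OF p] by (metis nat_neq_iff)
    then have "z ^ ((j - i) * x) = z ^ (p * y) * z" by simp
    then show False using 1 z by (simp add: power_mult)
  qed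
  have "inj_on (\<lambda>k. z ^ k) {..<p}"
    by (rule linorder_inj_onI) (use neq in auto)
  then have "card ((\<lambda>k. z ^ k) ` {..<p}) = p" by (simp add: card_image)
  moreover have "(\<lambda>k. z ^ k) ` {..<p} \<subseteq> {w. w ^ p = 1}"
    using z by (auto simp: power_commutes simp flip: power_mult) (metis mult.commute power_mult power_one)
  moreover have "card {w::complex. w ^ p = 1} = p" "finite {w::complex. w ^ p = 1}"
    using prime_gt_0_nat[OF p] by (auto intro: card_roots_unity_eq finite_roots_unity)
  ultimately have "(\<lambda>k. z ^ k) ` {..<p} = {w. w ^ p = 1}" by (metis card_subset_eq)
  then have "w \<in> (\<lambda>k. z ^ k) ` {..<p}" using w by simp
  then show ?thesis using that by auto
qed

context compact_bounded_group
begin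

lemma dualD:
  assumes "\<phi> \<in> dual"
  shows "\<phi> \<in> characters (carrier G)"
    "x \<in> carrier G \<Longrightarrow> \<phi> x \<noteq> 0"
    "x \<in> carrier G \<Longrightarrow> y \<in> carrier G \<Longrightarrow> \<phi> (x \<otimes> y) = \<phi> x * \<phi> y"
    "x \<in> carrier G \<Longrightarrow> \<phi> (x [^] (n::nat)) = \<phi> x ^ n"
    "x \<in> carrier G \<Longrightarrow> \<phi> x ^ N = 1"
    "x \<in> carrier G \<Longrightarrow> \<phi> (inv x) = inverse (\<phi> x)"
    "\<phi> \<one> = 1"
    "\<phi> \<in> extensional (carrier G)"
proof -
  show c: "\<phi> \<in> characters (carrier G)" using assms unfolding dual_def by blast
  show "x \<in> carrier G \<Longrightarrow> \<phi> x \<noteq> 0" "\<phi> \<in> extensional (carrier G)"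
    "x \<in> carrier G \<Longrightarrow> y \<in> carrier G \<Longrightarrow> \<phi> (x \<otimes> y) = \<phi> x * \<phi> y"
    using charactersD[OF c] by auto
  show "x \<in> carrier G \<Longrightarrow> \<phi> (x [^] n) = \<phi> x ^ n" using char_pow[OF subgroup_self c] .
  show "x \<in> carrier G \<Longrightarrow> \<phi> x ^ N = 1" using char_root(1)[OF subgroup_self c] .
  show "x \<in> carrier G \<Longrightarrow> \<phi> (inv x) = inverse (\<phi> x)" using char_inv(1)[OF subgroup_self c] .
  show "\<phi> \<one> = 1" using char_one[OF subgroup_self c] .
qed

text \<open>
  Characters take finitely many values, so their fibres are open as well as closed.
\<close>

lemma clopen_fibre:
  assumes \<phi>: "\<phi> \<in> dual"
  shows "openin T {x \<in> carrier G. \<phi> x = z}" "closedin T {x \<in> carrier G. \<phi> x = z}"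
proof -
  have cont: "continuous_map T euclidean \<phi>" using \<phi> unfolding dual_def by blast
  show "closedin T {x \<in> carrier G. \<phi> x = z}"
    using closedin_continuous_map_preimage[OF cont, of "{z}"] topspace_eq_carrier by simp
  let ?R = "{w. w ^ N = 1} - {z}"
  have "finite ?R" using exponent_pos by (intro finite_Diff finite_roots_unity) simp
  then have "open (- ?R)" by (intro open_Compl finite_imp_closed)
  then have "openin T {x \<in> topspace T. \<phi> x \<in> - ?R}"
    by (intro openin_continuous_map_preimage[OF cont]) simp
  also have "{x \<in> topspace T. \<phi> x \<in> - ?R} = {x \<in> carrier G. \<phi> x = z}"
    using dualD(5)[OF \<phi>] topspace_eq_carrier by auto
  finally show "openin T {x \<in> carrier G. \<phi> x = z}" .
qed

text \<open>
  Continuity under an arbitrary pointwise operation \<open>h\<close> is automatic because the fibres are clopen.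
\<close>

lemma dual_combine:
  assumes \<phi>: "\<phi> \<in> dual" and \<psi>: "\<psi> \<in> dual"
    and char: "(\<lambda>x\<in>carrier G. h (\<phi> x) (\<psi> x)) \<in> characters (carrier G)"
  shows "(\<lambda>x\<in>carrier G. h (\<phi> x) (\<psi> x)) \<in> dual"
proof -
  let ?f = "\<lambda>x\<in>carrier G. h (\<phi> x) (\<psi> x)"
  have "openin T {x \<in> topspace T. ?f x \<in> U}" for U
  proof -
    have "{x \<in> topspace T. ?f x \<in> U}
        = (\<Union>(a, b)\<in>{(a, b). h a b \<in> U}. {x \<in> carrier G. \<phi> x = a} \<inter> {x \<in> carrier G. \<psi> x = b})"
      using topspace_eq_carrier by auto
    moreover have "openin T \<dots>"
      using openin_Int[OF clopen_fibre(1)[OF \<phi>] clopen_fibre(1)[OF \<psi>]] by (intro openin_Union) auto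
    ultimately show ?thesis by simp
  qed
  then have "continuous_map T euclidean ?f" by (auto simp: continuous_map)
  then show ?thesis using char unfolding dual_def by blast
qed

definition dual_torsion :: "nat \<Rightarrow> ('a \<Rightarrow> complex) set" where
  "dual_torsion n = {\<phi> \<in> dual. \<forall>x\<in>carrier G. \<phi> x ^ n = 1}"

text \<open>
  The map \<open>P\<close> that sends \<open>\<phi>\<close> to its \<open>m\<close>-th power goes into the \<open>n\<close>-torsion, and two characters with the
  same image differ by an element of the \<open>m\<close>-torsion. With \<open>s\<close> a section of \<open>P\<close>, each \<open>\<phi>\<close> is the
  product of \<open>s (P \<phi>)\<close> and such an element.
\<close>

lemma countable_dual_torsion_mult:
  assumes "countable (dual_torsion m)" "countable (dual_torsion n)"
  shows "countable (dual_torsion (m * n))"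
proof -
  let ?P = "\<lambda>\<phi>. \<lambda>x\<in>carrier G. (\<phi> x :: complex) ^ m"
  define s where "s = inv_into (dual_torsion (m * n)) ?P"
  have "dual_torsion (m * n) \<subseteq> (\<lambda>(\<psi>, \<theta>). \<lambda>x\<in>carrier G. s \<psi> x * \<theta> x) ` (dual_torsion n \<times> dual_torsion m)"
  proof
    fix \<phi> assume \<phi>: "\<phi> \<in> dual_torsion (m * n)"
    then have d: "\<phi> \<in> dual" unfolding dual_torsion_def by blast
    have Pchar: "?P \<phi> \<in> characters (carrier G)"
      using dualD(2,3)[OF d] by (auto simp: characters_def power_mult_distrib)
    have "?P \<phi> \<in> dual" using dual_combine[OF d d, of "\<lambda>a b. a ^ m"] Pchar by simp
    then have P: "?P \<phi> \<in> dual_torsion n" using \<phi> unfolding dual_torsion_def by (auto simp: power_mult)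
    have "s (?P \<phi>) \<in> dual_torsion (m * n)" and Ps: "?P (s (?P \<phi>)) = ?P \<phi>"
      unfolding s_def using inv_into_into[OF imageI[OF \<phi>]] f_inv_into_f[OF imageI[OF \<phi>], of ?P] by blast+
    then have ds: "s (?P \<phi>) \<in> dual" unfolding dual_torsion_def by blast
    define \<theta> where "\<theta> = (\<lambda>x\<in>carrier G. \<phi> x * inverse (s (?P \<phi>) x))"
    have "\<theta> \<in> characters (carrier G)"
      unfolding \<theta>_def using dualD(2,3)[OF d] dualD(2,3)[OF ds] by (auto simp: characters_def)
    then have "\<theta> \<in> dual" unfolding \<theta>_def by (rule dual_combine[OF d ds, of "\<lambda>a b. a * inverse b"])
    moreover have "\<theta> x ^ m = 1" if x: "x \<in> carrier G" for x
    proof -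
      have "s (?P \<phi>) x ^ m = \<phi> x ^ m" using fun_cong[OF Ps, of x] x by simp
      then show ?thesis using x dualD(2)[OF d x] by (simp add: \<theta>_def power_mult_distrib power_inverse)
    qed
    ultimately have \<theta>: "\<theta> \<in> dual_torsion m" unfolding dual_torsion_def by blast
    have "\<phi> = (\<lambda>x\<in>carrier G. s (?P \<phi>) x * \<theta> x)"
      using dualD(8)[OF d] dualD(2)[OF ds] by (intro extensionalityI[of _ "carrier G"]) (auto simp: \<theta>_def)
    then show "\<phi> \<in> (\<lambda>(\<psi>, \<theta>). \<lambda>x\<in>carrier G. s \<psi> x * \<theta> x) ` (dual_torsion n \<times> dual_torsion m)"
      using P \<theta> by (intro image_eqI[of _ _ "(?P \<phi>, \<theta>)"]) auto
  qed
  then show ?thesis using assms by (meson countable_SIGMA countable_image countable_subset)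
qed

lemma countable_dual:
  assumes "\<And>p. prime p \<Longrightarrow> countable (dual_torsion p)"
  shows "countable dual"
proof -
  have "countable (dual_torsion n)" if "n > 0" for n using that
  proof (induction n rule: less_induct)
    case (less n)
    show ?case
    proof (cases "n = 1")
      case True
      have "\<phi> = (\<lambda>x\<in>carrier G. 1)" if "\<phi> \<in> dual_torsion 1" for \<phi>
        using that dualD(8) by (intro extensionalityI[of _ "carrier G"]) (auto simp: dual_torsion_def)
      then have "dual_torsion 1 \<subseteq> {\<lambda>x\<in>carrier G. 1}" by blast
      then show ?thesis using True by (metis countable_empty countable_insert countable_subset)
    next
      case False
      then obtain p where p: "prime p" "p dvd n" using prime_factor_nat by blast
      then obtain k where k: "n = p * k" by blast
      then have "k < n" "k > 0" using less.prems prime_gt_1_nat[OF p(1)] by auto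
      then show ?thesis using k less.IH assms[OF p(1)] countable_dual_torsion_mult by blast
    qed
  qed
  moreover have "dual = dual_torsion N" unfolding dual_torsion_def using dualD(5) by blast
  ultimately show ?thesis using exponent_pos by simp
qed

section \<open>Independent characters of prime order\<close>

definition depends_on :: "('a \<Rightarrow> complex) \<Rightarrow> ('a \<Rightarrow> complex) set \<Rightarrow> bool" where
  "depends_on \<phi> \<Phi> \<longleftrightarrow> (\<forall>x\<in>carrier G. (\<forall>\<psi>\<in>\<Phi>. \<psi> x = 1) \<longrightarrow> \<phi> x = 1)"

text \<open>
  The kernel of \<open>\<phi>\<close> and the complements of the kernels of the members of \<open>\<Phi>\<close> form an open cover.
\<close>

lemma depends_on_finite:
  assumes \<Phi>: "\<Phi> \<subseteq> dual" and \<phi>: "\<phi> \<in> dual" and ker: "depends_on \<phi> \<Phi>"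
  obtains J where "finite J" "J \<subseteq> \<Phi>" "depends_on \<phi> J"
proof -
  let ?k = "\<lambda>\<psi>. {x \<in> carrier G. \<psi> x = 1}" and ?c = "\<lambda>\<psi>. {x \<in> carrier G. \<psi> x \<noteq> 1}"
  have "openin T (?c \<psi>)" if "\<psi> \<in> \<Phi>" for \<psi>
  proof -
    have "openin T (topspace T - ?k \<psi>)" using clopen_fibre(2) that \<Phi> by blast
    moreover have "topspace T - ?k \<psi> = ?c \<psi>" using topspace_eq_carrier by auto
    ultimately show ?thesis by simp
  qed
  then have "\<forall>U\<in>insert (?k \<phi>) (?c ` \<Phi>). openin T U" using clopen_fibre(1)[OF \<phi>] by auto
  moreover have "topspace T \<subseteq> \<Union>(insert (?k \<phi>) (?c ` \<Phi>))" using ker topspace_eq_carrier unfolding depends_on_def by auto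
  ultimately obtain \<F> where \<F>: "finite \<F>" "\<F> \<subseteq> insert (?k \<phi>) (?c ` \<Phi>)" "topspace T \<subseteq> \<Union>\<F>"
    using compact[unfolded compact_space_alt, rule_format, of "insert (?k \<phi>) (?c ` \<Phi>)"] by auto
  then have "finite (\<F> - {?k \<phi>})" "\<F> - {?k \<phi>} \<subseteq> ?c ` \<Phi>" by auto
  then obtain J where J: "J \<subseteq> \<Phi>" "finite J" "\<F> - {?k \<phi>} = ?c ` J"
    by (meson finite_subset_image)
  have "\<phi> x = 1" if "x \<in> carrier G" "\<forall>\<psi>\<in>J. \<psi> x = 1" for x
  proof -
    obtain U where U: "U \<in> \<F>" "x \<in> U" using \<F>(3) \<open>x \<in> carrier G\<close> topspace_eq_carrier by auto
    then have "U = ?k \<phi> \<or> U \<in> ?c ` J" using J(3) by blast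
    then show ?thesis using U that by auto
  qed
  then have "depends_on \<phi> J" unfolding depends_on_def by blast
  then show ?thesis by (rule that[OF J(2,1)])
qed

text \<open>
  For characters of prime order this is linear independence over the field with \<open>p\<close> elements. It is
  phrased through points dual to the characters because those points are what later constructions use.
\<close>

definition independent :: "nat \<Rightarrow> ('a \<Rightarrow> complex) set \<Rightarrow> bool" where
  "independent p I \<longleftrightarrow> I \<subseteq> dual_torsion p \<and>
     (\<forall>\<phi>\<in>I. \<exists>y\<in>carrier G. \<phi> y \<noteq> 1 \<and> (\<forall>\<psi>\<in>I - {\<phi>}. \<psi> y = 1))"

text \<open>
  Zorn's lemma applies since independence has finite character: a dependence of \<open>\<phi>\<close> on the other
  members of a union of a chain is a dependence on finitely many of them, and these lie together with
  \<open>\<phi>\<close> in one member of the chain.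
\<close>

lemma ex_maximal_independent:
  obtains I where "independent p I" "\<And>J. independent p J \<Longrightarrow> I \<subseteq> J \<Longrightarrow> J = I"
proof -
  have "\<Union>\<C> \<in> {I. independent p I}" if ch: "subset.chain {I. independent p I} \<C>" for \<C>
  proof -
    have ind: "\<And>X. X \<in> \<C> \<Longrightarrow> independent p X" using ch by (auto simp: subset_chain_def)
    have sub: "\<Union>\<C> \<subseteq> dual_torsion p" using ind unfolding independent_def by blast
    have "\<exists>y\<in>carrier G. \<phi> y \<noteq> 1 \<and> (\<forall>\<psi>\<in>\<Union>\<C> - {\<phi>}. \<psi> y = 1)" if \<phi>: "\<phi> \<in> \<Union>\<C>" for \<phi>
    proof (rule ccontr)
      define K where "K = \<Union>\<C> - {\<phi>}"
      assume "\<not> (\<exists>y\<in>carrier G. \<phi> y \<noteq> 1 \<and> (\<forall>\<psi>\<in>\<Union>\<C> - {\<phi>}. \<psi> y = 1))"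
      then have "\<not> (\<exists>y\<in>carrier G. \<phi> y \<noteq> 1 \<and> (\<forall>\<psi>\<in>K. \<psi> y = 1))" unfolding K_def .
      then have ker: "depends_on \<phi> (\<Union>\<C> - {\<phi>})"
        unfolding depends_on_def K_def[symmetric] by blast
      have dual: "\<Union>\<C> - {\<phi>} \<subseteq> dual" "\<phi> \<in> dual" using sub \<phi> unfolding dual_torsion_def by auto
      obtain J where J: "finite J" "J \<subseteq> \<Union>\<C> - {\<phi>}" "depends_on \<phi> J"
        by (rule depends_on_finite[OF dual ker])
      have "finite (insert \<phi> J)" "insert \<phi> J \<subseteq> \<Union>\<C>" "\<C> \<noteq> {}" using J \<phi> by auto
      then obtain X where X: "X \<in> \<C>" "insert \<phi> J \<subseteq> X"
        using finite_subset_Union_chain ch by blast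
      then obtain y where "y \<in> carrier G" "\<phi> y \<noteq> 1" "\<forall>\<psi>\<in>X - {\<phi>}. \<psi> y = 1"
        using ind[OF X(1)] unfolding independent_def by blast
      then show False using J(2,3) X(2) unfolding depends_on_def by blast
    qed
    then show ?thesis using sub unfolding independent_def by blast
  qed
  then obtain I where "I \<in> {I. independent p I}" "\<forall>X\<in>{I. independent p I}. I \<subseteq> X \<longrightarrow> X = I"
    using subset_Zorn'[of "{I. independent p I}"] by blast
  then show ?thesis using that by blast
qed

end

locale maximal_independent = compact_bounded_group +
  fixes p :: nat and I
  assumes prime: "prime p" and independent: "independent p I"
    and maximal: "\<And>J. independent p J \<Longrightarrow> I \<subseteq> J \<Longrightarrow> J = I"
begin

lemma I_dual: "\<psi> \<in> I \<Longrightarrow> \<psi> \<in> dual" and I_pow: "\<psi> \<in> I \<Longrightarrow> x \<in> carrier G \<Longrightarrow> \<psi> x ^ p = 1"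
  using independent unfolding independent_def dual_torsion_def by auto

definition dual_point :: "('a \<Rightarrow> complex) \<Rightarrow> 'a" where
  "dual_point \<psi> = (SOME y. y \<in> carrier G \<and> \<psi> y \<noteq> 1 \<and> (\<forall>\<theta>\<in>I - {\<psi>}. \<theta> y = 1))"

lemma dual_point:
  assumes "\<psi> \<in> I"
  shows "dual_point \<psi> \<in> carrier G" "\<psi> (dual_point \<psi>) \<noteq> 1"
    "\<theta> \<in> I \<Longrightarrow> \<theta> \<noteq> \<psi> \<Longrightarrow> \<theta> (dual_point \<psi>) = 1"
proof -
  have "\<exists>y. y \<in> carrier G \<and> \<psi> y \<noteq> 1 \<and> (\<forall>\<theta>\<in>I - {\<psi>}. \<theta> y = 1)"
    using independent assms unfolding independent_def by blast
  from someI_ex[OF this] show "dual_point \<psi> \<in> carrier G" "\<psi> (dual_point \<psi>) \<noteq> 1"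
    "\<theta> \<in> I \<Longrightarrow> \<theta> \<noteq> \<psi> \<Longrightarrow> \<theta> (dual_point \<psi>) = 1"
    unfolding dual_point_def by auto
qed

text \<open>
  The exchange argument: if \<open>\<phi> x \<noteq> 1\<close>, then \<open>x\<close> is a dual point for \<open>\<phi>\<close>, and multiplying the other dual
  points by powers of \<open>x\<close> makes \<open>\<phi>\<close> trivial at them without changing the values of \<open>I\<close>. So \<open>I\<close>
  could be enlarged.
\<close>

lemma kernel_subset:
  assumes \<phi>: "\<phi> \<in> dual_torsion p" and x: "x \<in> carrier G" "\<forall>\<psi>\<in>I. \<psi> x = 1"
  shows "\<phi> x = 1"
proof (rule ccontr)
  assume \<phi>x: "\<phi> x \<noteq> 1"
  have \<phi>d: "\<phi> \<in> dual" and \<phi>p: "\<And>y. y \<in> carrier G \<Longrightarrow> \<phi> y ^ p = 1"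
    using \<phi> unfolding dual_torsion_def by auto
  have "\<phi> \<notin> I" using x \<phi>x by blast
  have "\<exists>y\<in>carrier G. \<psi> y \<noteq> 1 \<and> (\<forall>\<theta>\<in>insert \<phi> I - {\<psi>}. \<theta> y = 1)" if \<psi>: "\<psi> \<in> I" for \<psi>
  proof -
    let ?y = "dual_point \<psi>"
    note y = dual_point[OF \<psi>]
    have "inverse (\<phi> ?y) ^ p = 1" using \<phi>p[OF y(1)] by (simp add: power_inverse)
    then obtain k where k: "\<phi> x ^ k = inverse (\<phi> ?y)"
      using prime_root_of_unity_generates[OF prime \<phi>p[OF x(1)] \<phi>x] by blast
    \<comment> \<open>This is the corrected dual point of \<open>\<psi>\<close>: \<open>k\<close> was chosen to make \<open>\<phi>\<close> trivial there.\<close>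
    let ?z = "?y \<otimes> x [^] k"
    have z: "?z \<in> carrier G" using y x by simp
    have "\<phi> ?z = 1" using dualD(2,3,4)[OF \<phi>d] k y(1) x(1) by simp
    moreover have "\<theta> ?z = \<theta> ?y" if "\<theta> \<in> I" for \<theta>
      using dualD(3,4)[OF I_dual[OF that]] y(1) x(1) bspec[OF x(2) that] by simp
    ultimately have "\<psi> ?z \<noteq> 1" "\<forall>\<theta>\<in>insert \<phi> I - {\<psi>}. \<theta> ?z = 1"
      using y(2,3) \<psi> by (metis, metis DiffE insertE insertI1)
    then show ?thesis using z by blast
  qed
  moreover have "\<exists>y\<in>carrier G. \<phi> y \<noteq> 1 \<and> (\<forall>\<theta>\<in>insert \<phi> I - {\<phi>}. \<theta> y = 1)"
    using x \<phi>x by blast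
  ultimately have "independent p (insert \<phi> I)"
    using independent \<phi> unfolding independent_def by blast
  then show False using maximal[of "insert \<phi> I"] \<open>\<phi> \<notin> I\<close> by blast
qed

lemma finite_dependence:
  assumes "\<phi> \<in> dual_torsion p"
  obtains J where "finite J" "J \<subseteq> I" "depends_on \<phi> J"
proof -
  have "\<phi> \<in> dual" "I \<subseteq> dual" using assms I_dual unfolding dual_torsion_def by auto
  moreover have "depends_on \<phi> I" using kernel_subset[OF assms] unfolding depends_on_def by blast
  ultimately show ?thesis using depends_on_finite that by blast
qed

text \<open>
  The point \<open>z\<close> is a product of powers of dual points. This yields the last clause, which says that
  characters with the same values at the dual points agree at \<open>z\<close>.
\<close>

lemma interpolate:
  assumes J: "finite J" "J \<subseteq> I" and x: "x \<in> carrier G"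
  obtains z where "z \<in> carrier G" "\<And>\<psi>. \<psi> \<in> J \<Longrightarrow> \<psi> z = \<psi> x" "\<And>\<psi>. \<psi> \<in> I - J \<Longrightarrow> \<psi> z = 1"
    "\<And>\<phi> \<phi>'. \<phi> \<in> dual \<Longrightarrow> \<phi>' \<in> dual \<Longrightarrow> \<forall>\<psi>\<in>I. \<phi> (dual_point \<psi>) = \<phi>' (dual_point \<psi>) \<Longrightarrow> \<phi> z = \<phi>' z"
proof -
  have "\<exists>z\<in>carrier G. (\<forall>\<psi>\<in>J. \<psi> z = \<psi> x) \<and> (\<forall>\<psi>\<in>I - J. \<psi> z = 1) \<and>
    (\<forall>\<phi>\<in>dual. \<forall>\<phi>'\<in>dual. (\<forall>\<psi>\<in>I. \<phi> (dual_point \<psi>) = \<phi>' (dual_point \<psi>)) \<longrightarrow> \<phi> z = \<phi>' z)"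
    using J
  proof (induction J rule: finite_induct)
    case empty
    have "\<phi> \<one> = \<phi>' \<one>" if "\<phi> \<in> dual" "\<phi>' \<in> dual" for \<phi> \<phi>'
      using dualD(7)[OF that(1)] dualD(7)[OF that(2)] by simp
    then show ?case using dualD(7)[OF I_dual] by (intro bexI[of _ "\<one>"]) auto
  next
    case (insert \<psi> J)
    then obtain z where z: "z \<in> carrier G" "\<forall>\<theta>\<in>J. \<theta> z = \<theta> x" "\<forall>\<theta>\<in>I - J. \<theta> z = 1"
      "\<forall>\<phi>\<in>dual. \<forall>\<phi>'\<in>dual. (\<forall>\<psi>\<in>I. \<phi> (dual_point \<psi>) = \<phi>' (dual_point \<psi>)) \<longrightarrow> \<phi> z = \<phi>' z"
      by auto
    have \<psi>: "\<psi> \<in> I" using insert.prems by blast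
    let ?y = "dual_point \<psi>"
    note y = dual_point[OF \<psi>]
    obtain k where k: "\<psi> ?y ^ k = \<psi> x"
      using prime_root_of_unity_generates[OF prime I_pow[OF \<psi> y(1)] y(2) I_pow[OF \<psi> x]] by blast
    let ?z = "z \<otimes> ?y [^] k"
    have eval: "\<phi> ?z = \<phi> z * \<phi> ?y ^ k" if "\<phi> \<in> dual" for \<phi>
      using dualD(3,4)[OF that] z(1) y(1) by simp
    have \<psi>z: "\<psi> ?z = \<psi> x" using eval[OF I_dual[OF \<psi>]] k z(3) \<psi> insert.hyps by simp
    have \<theta>z: "\<theta> ?z = \<theta> z" if "\<theta> \<in> I" "\<theta> \<noteq> \<psi>" for \<theta>
      using eval[OF I_dual[OF that(1)]] y(3)[OF that] by simp
    have "?z \<in> carrier G" using z(1) y(1) by simp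
    moreover have "\<forall>\<theta>\<in>insert \<psi> J. \<theta> ?z = \<theta> x"
      using \<psi>z \<theta>z z(2) insert.prems by (metis insert_iff subsetD)
    moreover have "\<forall>\<theta>\<in>I - insert \<psi> J. \<theta> ?z = 1"
      using \<theta>z z(3) by (metis DiffE DiffI insertCI)
    moreover have "\<phi> ?z = \<phi>' ?z"
      if "\<phi> \<in> dual" "\<phi>' \<in> dual" "\<forall>\<psi>\<in>I. \<phi> (dual_point \<psi>) = \<phi>' (dual_point \<psi>)" for \<phi> \<phi>'
      using eval[OF that(1)] eval[OF that(2)] that z(4) \<psi> by simp
    ultimately show ?case by blast
  qed
  then show ?thesis using that by blast
qed

lemma agree_if_depends_on:
  assumes \<phi>: "\<phi> \<in> dual" and J: "J \<subseteq> I"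
    and ker: "depends_on \<phi> J"
    and xz: "x \<in> carrier G" "z \<in> carrier G" "\<And>\<psi>. \<psi> \<in> J \<Longrightarrow> \<psi> z = \<psi> x"
  shows "\<phi> z = \<phi> x"
proof -
  have "\<psi> (z \<otimes> inv x) = 1" if "\<psi> \<in> J" for \<psi>
  proof -
    have "\<psi> \<in> dual" using that J I_dual by blast
    from dualD(2,3,6)[OF this] show ?thesis using xz(1,2) xz(3)[OF that] by simp
  qed
  then have "\<phi> (z \<otimes> inv x) = 1" using ker xz(1,2) unfolding depends_on_def by simp
  then show ?thesis using dualD(2,3,6)[OF \<phi>] xz by (simp add: field_simps)
qed

text \<open>
  A character of order dividing \<open>p\<close> is determined by its values at the dual points, and only finitely
  many of these values differ from 1. So it is encoded by a finite subset of a countable set.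
\<close>

lemma countable_dual_torsion:
  assumes "countable I"
  shows "countable (dual_torsion p)"
proof -
  let ?R = "{z::complex. z ^ N = 1}"
  let ?g = "\<lambda>\<phi>. {(\<psi>, \<phi> (dual_point \<psi>)) | \<psi>. \<psi> \<in> I \<and> \<phi> (dual_point \<psi>) \<noteq> 1}"
  have "inj_on ?g (dual_torsion p)"
  proof (rule inj_onI)
    fix \<phi> \<phi>' assume *: "\<phi> \<in> dual_torsion p" "\<phi>' \<in> dual_torsion p" and eq: "?g \<phi> = ?g \<phi>'"
    then have d: "\<phi> \<in> dual" "\<phi>' \<in> dual" unfolding dual_torsion_def by auto
    have points: "\<phi> (dual_point \<psi>) = \<phi>' (dual_point \<psi>)" if "\<psi> \<in> I" for \<psi>
    proof -
      have iff: "(\<psi>, w) \<in> ?g \<theta> \<longleftrightarrow> w = \<theta> (dual_point \<psi>) \<and> w \<noteq> 1" for w \<theta>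
        using that by auto
      have "w = \<phi> (dual_point \<psi>) \<and> w \<noteq> 1 \<longleftrightarrow> w = \<phi>' (dual_point \<psi>) \<and> w \<noteq> 1" for w
        unfolding iff[symmetric] eq ..
      then show ?thesis by metis
    qed
    obtain J where J: "finite J" "J \<subseteq> I" "depends_on \<phi> J"
      using finite_dependence[OF *(1)] by blast
    obtain J' where J': "finite J'" "J' \<subseteq> I" "depends_on \<phi>' J'"
      using finite_dependence[OF *(2)] by blast
    show "\<phi> = \<phi>'"
    proof (rule extensionalityI[OF dualD(8)[OF d(1)] dualD(8)[OF d(2)]])
      fix x assume x: "x \<in> carrier G"
      have JJ: "finite (J \<union> J')" "J \<union> J' \<subseteq> I" using J J' by auto
      obtain z where z: "z \<in> carrier G" "\<And>\<psi>. \<psi> \<in> J \<union> J' \<Longrightarrow> \<psi> z = \<psi> x" "\<phi> z = \<phi>' z"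
        using interpolate[OF JJ x] points d by metis
      then show "\<phi> x = \<phi>' x"
        using agree_if_depends_on[OF d(1) J(2,3) x z(1)] agree_if_depends_on[OF d(2) J'(2,3) x z(1)] by simp
    qed
  qed
  moreover have "?g ` dual_torsion p \<subseteq> {A. finite A \<and> A \<subseteq> I \<times> ?R}"
  proof (intro image_subsetI CollectI conjI)
    fix \<phi> assume \<phi>: "\<phi> \<in> dual_torsion p"
    then have d: "\<phi> \<in> dual" unfolding dual_torsion_def by blast
    obtain J where J: "finite J" "J \<subseteq> I" "depends_on \<phi> J"
      using finite_dependence[OF \<phi>] by blast
    have "\<psi> \<in> J" if "\<psi> \<in> I" "\<phi> (dual_point \<psi>) \<noteq> 1" for \<psi>
      using J(2,3) dual_point(1,3)[OF that(1)] that(2) unfolding depends_on_def by blast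
    then have "?g \<phi> \<subseteq> (\<lambda>\<psi>. (\<psi>, \<phi> (dual_point \<psi>))) ` J" by blast
    then show "finite (?g \<phi>)" using J(1) by (meson finite_imageI finite_subset)
    show "?g \<phi> \<subseteq> I \<times> ?R" using dualD(5)[OF d] dual_point(1) by auto
  qed
  moreover have "finite ?R" using exponent_pos by (intro finite_roots_unity) simp
  then have "countable {A. finite A \<and> A \<subseteq> I \<times> ?R}"
    using assms by (intro countable_Collect_finite_subset countable_SIGMA) (auto intro: countable_finite)
  ultimately show ?thesis by (meson countable_image_inj_on countable_subset)
qed

text \<open>
  The analogue of the direct sum inside a direct product, with the members of \<open>I\<close> as coordinates.
\<close>

definition finite_support :: "'a set" where
  "finite_support = {x \<in> carrier G. finite {\<psi> \<in> I. \<psi> x \<noteq> 1}}"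

lemma subgroup_finite_support: "subgroup finite_support G"
proof (rule subgroupI)
  show "finite_support \<subseteq> carrier G" unfolding finite_support_def by blast
  have "{\<psi> \<in> I. \<psi> \<one> \<noteq> 1} = {}" using dualD(7)[OF I_dual] by blast
  then have "\<one> \<in> finite_support" unfolding finite_support_def by (simp only: mem_Collect_eq one_closed finite.emptyI simp_thms)
  then show "finite_support \<noteq> {}" by blast
  show "inv x \<in> finite_support" if "x \<in> finite_support" for x
  proof -
    have x: "x \<in> carrier G" "finite {\<psi> \<in> I. \<psi> x \<noteq> 1}" using that unfolding finite_support_def by auto
    have "\<psi> (inv x) = 1" if "\<psi> \<in> I" "\<psi> x = 1" for \<psi>
      using dualD(6)[OF I_dual[OF that(1)] x(1)] that(2) by simp
    then have "{\<psi> \<in> I. \<psi> (inv x) \<noteq> 1} \<subseteq> {\<psi> \<in> I. \<psi> x \<noteq> 1}" by blast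
    then show ?thesis using x finite_subset unfolding finite_support_def by blast
  qed
  show "x \<otimes> y \<in> finite_support" if "x \<in> finite_support" "y \<in> finite_support" for x y
  proof -
    have xy: "x \<in> carrier G" "y \<in> carrier G" "finite ({\<psi> \<in> I. \<psi> x \<noteq> 1} \<union> {\<psi> \<in> I. \<psi> y \<noteq> 1})"
      using that unfolding finite_support_def by auto
    have "\<psi> (x \<otimes> y) = 1" if "\<psi> \<in> I" "\<psi> x = 1" "\<psi> y = 1" for \<psi>
      using dualD(3)[OF I_dual[OF that(1)] xy(1,2)] that(2,3) by simp
    then have "{\<psi> \<in> I. \<psi> (x \<otimes> y) \<noteq> 1} \<subseteq> {\<psi> \<in> I. \<psi> x \<noteq> 1} \<union> {\<psi> \<in> I. \<psi> y \<noteq> 1}" by blast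
    then show ?thesis using xy finite_subset unfolding finite_support_def by blast
  qed
qed

text \<open>
  The closure is a closed subgroup, so if it were proper, a nontrivial \<open>\<phi>\<close> would be trivial on it.
  All \<open>p\<close>-th powers have empty support, so \<open>\<phi>\<close> has order dividing \<open>p\<close> and depends on a finite
  \<open>J \<subseteq> I\<close>. A point with support in \<open>J\<close> that agrees with \<open>x\<close> on \<open>J\<close> contradicts \<open>\<phi> x \<noteq> 1\<close>.
\<close>

lemma dense_finite_support: "dense_subset T finite_support"
proof -
  let ?H = finite_support and ?K = "T closure_of finite_support"
  note H = subgroup_finite_support
  have HG: "?H \<subseteq> carrier G" using subgroup.subset[OF H] .
  have HK: "?H \<subseteq> ?K" using HG topspace_eq_carrier by (simp add: closure_of_subset)
  have KG: "?K \<subseteq> carrier G" using closure_of_subset_topspace topspace_eq_carrier by metis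
  have min: "?K \<subseteq> {z \<in> carrier G. x \<otimes> z \<in> ?K}" if "x \<in> carrier G" "\<And>h. h \<in> ?H \<Longrightarrow> x \<otimes> h \<in> ?K" for x
    using closedin_translation[OF that(1) closedin_closure_of] that(2) HG by (intro closure_of_minimal) auto
  \<comment> \<open>Closure under multiplication in two steps: first \<open>h \<otimes> z\<close> for fixed \<open>h\<close> in the dense subgroup and varying \<open>z\<close>, then \<open>z \<otimes> w\<close> for fixed \<open>z\<close> and varying \<open>w\<close>.\<close>
  have m1: "h \<otimes> z \<in> ?K" if "h \<in> ?H" "z \<in> ?K" for h z
    using min[of h] that HG HK subgroup.m_closed[OF H] by blast
  have m: "z \<otimes> w \<in> ?K" if "z \<in> ?K" "w \<in> ?K" for z w
  proof -
    have "z \<otimes> h \<in> ?K" if "h \<in> ?H" for h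
      using m1[OF that \<open>z \<in> ?K\<close>] m_comm[of z h] \<open>z \<in> ?K\<close> that HG KG by (simp add: subset_iff)
    then show ?thesis using min[of z] that KG by blast
  qed
  have one: "\<one> \<in> ?K" using subgroup.one_closed[OF H] HK by blast
  have pow: "z [^] (n::nat) \<in> ?K" if "z \<in> ?K" for z n
    by (induction n) (use one m that in auto)
  have K: "subgroup ?K G"
  proof (rule subgroupI[OF KG])
    show "?K \<noteq> {}" using one by blast
    show "inv z \<in> ?K" if "z \<in> ?K" for z using pow[OF that] inv_eq_pow[of z] KG that by auto
  qed (rule m)
  have "?K = carrier G"
  proof (rule ccontr)
    assume "?K \<noteq> carrier G"
    then obtain x where x: "x \<in> carrier G" "x \<notin> ?K" using KG by blast
    obtain \<phi> where \<phi>: "\<phi> \<in> dual" "\<And>k. k \<in> ?K \<Longrightarrow> \<phi> k = 1" "\<phi> x \<noteq> 1"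
      using dual_separates_closed_subgroup[OF K closedin_closure_of x] by metis
    have "\<phi> y ^ p = 1" if y: "y \<in> carrier G" for y
    proof -
      have "\<psi> (y [^] p) = 1" if "\<psi> \<in> I" for \<psi>
        using dualD(4)[OF I_dual[OF that] y] I_pow[OF that y] by simp
      then have "{\<psi> \<in> I. \<psi> (y [^] p) \<noteq> 1} = {}" by blast
      then have "y [^] p \<in> ?H" unfolding finite_support_def using y by (simp only: mem_Collect_eq nat_pow_closed finite.emptyI simp_thms)
      then show ?thesis using \<phi>(2) HK dualD(4)[OF \<phi>(1) y, of p] by auto
    qed
    then have "\<phi> \<in> dual_torsion p" using \<phi>(1) unfolding dual_torsion_def by blast
    then obtain J where J: "finite J" "J \<subseteq> I" "depends_on \<phi> J"
      using finite_dependence by blast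
    obtain z where z: "z \<in> carrier G" "\<And>\<psi>. \<psi> \<in> J \<Longrightarrow> \<psi> z = \<psi> x" "\<And>\<psi>. \<psi> \<in> I - J \<Longrightarrow> \<psi> z = 1"
      using interpolate[OF J(1,2) x(1)] by metis
    have "{\<psi> \<in> I. \<psi> z \<noteq> 1} \<subseteq> J" using z(3) by blast
    then have "z \<in> ?H" unfolding finite_support_def using z(1) J(1) finite_subset by blast
    then have "\<phi> z = 1" using \<phi>(2) HK by blast
    then show False using agree_if_depends_on[OF \<phi>(1) J(2,3) x(1) z(1,2)] \<phi>(3) by simp
  qed
  then show ?thesis unfolding dense_subset_def using HG topspace_eq_carrier by simp
qed

text \<open>
  Each point of a countable dense set \<open>D\<close> is nontrivial for only finitely many members of \<open>I\<close>. A member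
  that is trivial on all of \<open>D\<close> would be trivial everywhere, by density.
\<close>

lemma countable_if_separable:
  assumes "separable_space (subtopology T finite_support)"
  shows "countable I"
proof -
  let ?H = finite_support
  have HG: "?H \<subseteq> carrier G" using subgroup.subset[OF subgroup_finite_support] .
  obtain D where D: "countable D" "D \<subseteq> topspace (subtopology T ?H)"
    "subtopology T ?H closure_of D = topspace (subtopology T ?H)"
    using assms unfolding separable_space_def by blast
  then have DH: "D \<subseteq> ?H" by auto
  have "?H \<subseteq> T closure_of D"
    using D(3) HG topspace_eq_carrier by (auto simp: closure_of_subtopology DH Int_absorb1)
  then have "T closure_of ?H \<subseteq> T closure_of D" by (simp add: closure_of_minimal)
  then have dense: "carrier G \<subseteq> T closure_of D"
    using dense_finite_support topspace_eq_carrier unfolding dense_subset_def by simp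
  have "I \<subseteq> (\<Union>d\<in>D. {\<psi> \<in> I. \<psi> d \<noteq> 1})"
  proof
    fix \<psi> assume \<psi>: "\<psi> \<in> I"
    show "\<psi> \<in> (\<Union>d\<in>D. {\<psi> \<in> I. \<psi> d \<noteq> 1})"
    proof (rule ccontr)
      assume "\<psi> \<notin> (\<Union>d\<in>D. {\<psi> \<in> I. \<psi> d \<noteq> 1})"
      then have "D \<subseteq> {x \<in> carrier G. \<psi> x = 1}" using \<psi> DH HG by auto
      then have "T closure_of D \<subseteq> {x \<in> carrier G. \<psi> x = 1}"
        using clopen_fibre(2)[OF I_dual[OF \<psi>]] by (intro closure_of_minimal)
      then show False using dense dual_point(1,2)[OF \<psi>] by blast
    qed
  qed
  moreover have "countable {\<psi> \<in> I. \<psi> d \<noteq> 1}" if "d \<in> D" for d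
    using that DH by (intro countable_finite) (auto simp: finite_support_def)
  ultimately show ?thesis using D(1) by (meson countable_UN countable_subset)
qed

end

section \<open>From a countable dual group to metrizability\<close>

text \<open>
  The indicator functions of the members of \<open>S\<close> embed the space into a countable power of a two-point
  space. For a countable base, fix \<open>x \<in> U\<close>: the members of \<open>S\<close> around \<open>x\<close> intersect in \<open>{x}\<close>, so by
  compactness finitely many of them intersect within \<open>U\<close>.
\<close>

lemma compact_clopen_separated:
  assumes T: "compact_space T" and S: "countable S" "\<And>V. V \<in> S \<Longrightarrow> openin T V \<and> closedin T V"
    and sep: "\<And>x y. x \<in> topspace T \<Longrightarrow> y \<in> topspace T \<Longrightarrow> x \<noteq> y \<Longrightarrow> \<exists>V\<in>S. x \<in> V \<and> y \<notin> V"
  shows "metrizable_space T" "second_countable T"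
proof -
  let ?X = "product_topology (\<lambda>_. discrete_topology (UNIV :: bool set)) S"
  let ?e = "\<lambda>x. \<lambda>V\<in>S. x \<in> V"
  have "continuous_map T (discrete_topology UNIV) (\<lambda>x. x \<in> V)" if "V \<in> S" for V
    unfolding continuous_map
  proof (intro conjI allI impI)
    fix U :: "bool set"
    have "{x \<in> topspace T. (x \<in> V) \<in> U} = (if True \<in> U then V else {}) \<union> (if False \<in> U then topspace T - V else {})"
      using S(2)[OF that] openin_subset[of T V] by (auto, (metis (full_types))+)
    then show "openin T {x \<in> topspace T. (x \<in> V) \<in> U}" using S(2)[OF that] by auto
  qed simp
  then have "continuous_map T ?X ?e"
    unfolding continuous_map_componentwise by (auto simp: image_subset_iff)
  moreover have X: "metrizable_space ?X"
    using S(1) by (simp add: metrizable_space_product_topology metrizable_space_discrete_topology countable_subset[of "{i \<in> S. _ i}" S])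
  then have "Hausdorff_space ?X" by (rule metrizable_imp_Hausdorff_space)
  moreover have "inj_on ?e (topspace T)"
  proof (rule inj_onI, rule ccontr)
    fix x y assume xy: "x \<in> topspace T" "y \<in> topspace T" "?e x = ?e y" "x \<noteq> y"
    then obtain V where "V \<in> S" "x \<in> V" "y \<notin> V" using sep by blast
    then show False using fun_cong[OF xy(3), of V] by simp
  qed
  ultimately have "embedding_map T ?X ?e"
    using T continuous_imp_closed_map injective_closed_imp_embedding_map by blast
  then have "T homeomorphic_space (subtopology ?X (?e ` topspace T))"
    by (rule embedding_map_imp_homeomorphic_space)
  then show "metrizable_space T"
    using X homeomorphic_metrizable_space metrizable_space_subtopology by blast
  let ?B = "(\<lambda>\<A>. topspace T \<inter> \<Inter>\<A>) ` {\<A>. finite \<A> \<and> \<A> \<subseteq> S}"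
  show "second_countable T"
    unfolding second_countable_def
  proof (intro exI[of _ ?B] conjI ballI allI impI)
    show "countable ?B" using countable_Collect_finite_subset[OF S(1)] by blast
    show "openin T W" if "W \<in> ?B" for W
    proof -
      obtain \<A> where A: "finite \<A>" "\<A> \<subseteq> S" "W = topspace T \<inter> \<Inter>\<A>" using \<open>W \<in> ?B\<close> by blast
      have "openin T (\<Inter>(insert (topspace T) \<A>))"
        using A S(2) by (intro openin_Inter) auto
      then show ?thesis using A(3) by simp
    qed
    fix U x assume Ux: "openin T U \<and> x \<in> U"
    then have x: "x \<in> topspace T" using openin_subset by blast
    let ?c = "\<lambda>V. topspace T - V"
    let ?C = "insert U (?c ` {V \<in> S. x \<in> V})"
    have "\<forall>V\<in>?C. openin T V" using Ux S(2) by auto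
    moreover have "topspace T \<subseteq> \<Union>?C" using sep[OF x] Ux by auto
    ultimately obtain \<F> where \<F>: "finite \<F>" "\<F> \<subseteq> ?C" "topspace T \<subseteq> \<Union>\<F>"
      using T[unfolded compact_space_alt, rule_format, of ?C] by auto
    then have "finite (\<F> - {U})" "\<F> - {U} \<subseteq> ?c ` {V \<in> S. x \<in> V}" by auto
    then obtain \<A> where A: "\<A> \<subseteq> {V \<in> S. x \<in> V}" "finite \<A>" "\<F> - {U} = ?c ` \<A>"
      by (meson finite_subset_image)
    have "topspace T \<inter> \<Inter>\<A> \<subseteq> U"
    proof
      fix y assume y: "y \<in> topspace T \<inter> \<Inter>\<A>"
      then obtain V where V: "V \<in> \<F>" "y \<in> V" using \<F>(3) by auto
      show "y \<in> U"
      proof (rule ccontr)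
        assume "y \<notin> U"
        then have "V \<in> \<F> - {U}" using V by blast
        then obtain A where "A \<in> \<A>" "V = topspace T - A" using A(3) by auto
        then show False using V y by blast
      qed
    qed
    then show "\<exists>V\<in>?B. x \<in> V \<and> V \<subseteq> U" using A x by (intro bexI[of _ "topspace T \<inter> \<Inter>\<A>"]) auto
  qed
qed

context compact_bounded_group
begin

lemma countable_dual_torsion_if_separable:
  assumes p: "prime p" and sep: "dense_subgroup_separable G T"
  shows "countable (dual_torsion p)"
proof -
  obtain I where I: "independent p I" "\<And>J. independent p J \<Longrightarrow> I \<subseteq> J \<Longrightarrow> J = I"
    using ex_maximal_independent by blast
  interpret maximal_independent G T N p I
    by unfold_locales (use p I in auto)
  have "separable_space (subtopology T finite_support)"
    using sep subgroup_finite_support dense_finite_support unfolding dense_subgroup_separable_def by blast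
  then show ?thesis using countable_dual_torsion countable_if_separable by blast
qed

lemma countable_dual_imp_metrizable:
  assumes "countable dual"
  shows "metrizable_space T" "second_countable T"
proof -
  let ?R = "{z::complex. z ^ N = 1}"
  let ?S = "(\<lambda>(\<phi>, z). {x \<in> carrier G. \<phi> x = z}) ` (dual \<times> ?R)"
  have "finite ?R" using exponent_pos by (intro finite_roots_unity) simp
  then have S: "countable ?S" using assms countable_finite by (intro countable_image countable_SIGMA) auto
  have clopen: "openin T V \<and> closedin T V" if "V \<in> ?S" for V
    using that clopen_fibre by auto
  have sep: "\<exists>V\<in>?S. x \<in> V \<and> y \<notin> V" if xy: "x \<in> topspace T" "y \<in> topspace T" "x \<noteq> y" for x y
  proof -
    have G: "x \<in> carrier G" "y \<in> carrier G" using xy topspace_eq_carrier by auto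
    have "closedin T {\<one>}"
      using Hausdorff topspace_eq_carrier by (simp add: closedin_Hausdorff_singleton)
    moreover have "x \<otimes> inv y \<in> carrier G" using G by simp
    moreover have "x \<otimes> inv y \<notin> {\<one>}" using mult_inv_eq_one_iff[OF G] xy(3) by auto
    ultimately obtain \<phi> where \<phi>: "\<phi> \<in> dual" "\<phi> (x \<otimes> inv y) \<noteq> 1"
      using dual_separates_closed_subgroup[OF triv_subgroup] by metis
    then have "\<phi> y \<noteq> \<phi> x" using dualD(2,3,6)[OF \<phi>(1)] G by auto
    moreover have "(\<phi>, \<phi> x) \<in> dual \<times> ?R" using \<phi>(1) dualD(5)[OF \<phi>(1) G(1)] by blast
    ultimately show ?thesis using G by (intro bexI[of _ "{z \<in> carrier G. \<phi> z = \<phi> x}"]) (auto intro!: image_eqI[of _ _ "(\<phi>, \<phi> x)"])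
  qed
  show "metrizable_space T" "second_countable T"
    using compact_clopen_separated[OF compact S clopen sep] by auto
qed

end

section \<open>Compact torsion groups have bounded exponent\<close>

text \<open>
  The closed subgroups of elements of order dividing \<open>n\<close>, for \<open>n > 0\<close>, cover the group, so by Baire's
  theorem one of them has nonempty interior. Finitely many translates \<open>U s\<close> of that interior cover the
  group, and every \<open>x \<in> U s\<close> satisfies \<open>x [^] n = s [^] n\<close>. Multiplying \<open>n\<close> by the orders of the finitely
  many \<open>s\<close> gives the exponent.
\<close>

lemma compact_torsion_exponent:
  assumes TG: "topological_group G T" and CG: "comm_group G" and tor: "torsion_group G"
    and compact: "compact_space T" and Haus: "Hausdorff_space T"
  obtains N :: nat where "N > 0" "\<And>x. x \<in> carrier G \<Longrightarrow> x [^]\<^bsub>G\<^esub> N = \<one>\<^bsub>G\<^esub>"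
proof -
  interpret topological_group G T by fact
  interpret comm_group G by fact
  let ?E = "\<lambda>n::nat. {x \<in> carrier G. x [^]\<^bsub>G\<^esub> n = \<one>\<^bsub>G\<^esub>}"
  have cont: "continuous_map T T (\<lambda>x. x [^]\<^bsub>G\<^esub> n)" for n :: nat
  proof (induction n)
    case 0
    then show ?case using topspace_eq_carrier by simp
  next
    case (Suc n)
    have "continuous_map T (prod_topology T T) (\<lambda>x. (x [^]\<^bsub>G\<^esub> n, x))"
      using Suc by (intro continuous_map_pairedI) auto
    from continuous_map_compose[OF this continuous_mult] show ?case by (simp add: o_def)
  qed
  have closed: "closedin T (?E n)" for n
  proof -
    have "closedin T {\<one>\<^bsub>G\<^esub>}"
      using Haus topspace_eq_carrier by (simp add: closedin_Hausdorff_singleton)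
    from closedin_continuous_map_preimage[OF cont this] show ?thesis using topspace_eq_carrier by simp
  qed
  have "\<exists>n>0. T interior_of (?E n) \<noteq> {}"
  proof (rule ccontr)
    assume none: "\<not> ?thesis"
    have "T interior_of \<Union>(?E ` {0<..}) = {}"
    proof (rule Baire_category_alt)
      show "completely_metrizable_space T \<or> locally_compact_space T \<and> regular_space T"
        using compact Haus compact_imp_locally_compact_space compact_Hausdorff_imp_regular_space by blast
      show "countable (?E ` {0<..})" by simp
      show "closedin T C \<and> T interior_of C = {}" if "C \<in> ?E ` {0<..}" for C
        using that closed none by blast
    qed
    moreover have "\<Union>(?E ` {0<..}) = topspace T"
      using tor topspace_eq_carrier unfolding torsion_group_def by auto
    ultimately show False using topspace_eq_carrier interior_of_topspace[of T] by auto
  qed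
  then obtain n w where n: "n > 0" and w: "w \<in> T interior_of (?E n)" by blast
  let ?W = "T interior_of (?E n)"
  have W: "openin T ?W" "?W \<subseteq> ?E n" by (rule openin_interior_of, rule interior_of_subset)
  have wG: "w \<in> carrier G" and wn: "w [^]\<^bsub>G\<^esub> n = \<one>\<^bsub>G\<^esub>" using w W by auto
  let ?U = "\<lambda>s. {z \<in> carrier G. (w \<otimes>\<^bsub>G\<^esub> inv\<^bsub>G\<^esub> s) \<otimes>\<^bsub>G\<^esub> z \<in> ?W}"
  have "openin T (?U s)" if "s \<in> carrier G" for s
  proof -
    have "continuous_map T (prod_topology T T) (\<lambda>z. (w \<otimes>\<^bsub>G\<^esub> inv\<^bsub>G\<^esub> s, z))"
      using that wG topspace_eq_carrier by (intro continuous_map_pairedI) auto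
    from openin_continuous_map_preimage[OF continuous_map_compose[OF this continuous_mult] W(1)]
    show ?thesis using topspace_eq_carrier by (simp add: o_def)
  qed
  then have "\<forall>U\<in>?U ` carrier G. openin T U" by blast
  moreover have "topspace T \<subseteq> \<Union>(?U ` carrier G)"
  proof
    fix s assume "s \<in> topspace T"
    then have s: "s \<in> carrier G" using topspace_eq_carrier by simp
    then have "(w \<otimes>\<^bsub>G\<^esub> inv\<^bsub>G\<^esub> s) \<otimes>\<^bsub>G\<^esub> s = w" using wG by (simp add: m_assoc)
    then have "s \<in> ?U s" using s w by simp
    then show "s \<in> \<Union>(?U ` carrier G)" by (rule UN_I[OF s])
  qed
  ultimately obtain \<F> where \<F>: "finite \<F>" "\<F> \<subseteq> ?U ` carrier G" "topspace T \<subseteq> \<Union>\<F>"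
    using compact[unfolded compact_space_alt, rule_format, of "?U ` carrier G"] by auto
  then obtain S where S: "S \<subseteq> carrier G" "finite S" "\<F> = ?U ` S"
    by (meson finite_subset_image)
  have "\<forall>s\<in>S. \<exists>k::nat. k > 0 \<and> s [^]\<^bsub>G\<^esub> k = \<one>\<^bsub>G\<^esub>"
    using tor S(1) unfolding torsion_group_def by blast
  then obtain m :: "'a \<Rightarrow> nat" where m: "\<And>s. s \<in> S \<Longrightarrow> m s > 0 \<and> s [^]\<^bsub>G\<^esub> m s = \<one>\<^bsub>G\<^esub>" by metis
  let ?N = "n * (\<Prod>s\<in>S. m s)"
  have "?N > 0" using n m by (simp add: prod_pos)
  moreover have "x [^]\<^bsub>G\<^esub> ?N = \<one>\<^bsub>G\<^esub>" if x: "x \<in> carrier G" for x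
  proof -
    obtain s where s: "s \<in> S" "x \<in> ?U s" using \<F>(3) S(3) x topspace_eq_carrier by auto
    have sG: "s \<in> carrier G" using s S by blast
    let ?v = "(w \<otimes>\<^bsub>G\<^esub> inv\<^bsub>G\<^esub> s) \<otimes>\<^bsub>G\<^esub> x"
    have vG: "?v \<in> carrier G" using wG sG x by simp
    have vn: "?v [^]\<^bsub>G\<^esub> n = \<one>\<^bsub>G\<^esub>" using s(2) W(2) by blast
    have "?v = (w \<otimes>\<^bsub>G\<^esub> x) \<otimes>\<^bsub>G\<^esub> inv\<^bsub>G\<^esub> s" using wG sG x by (simp add: m_ac)
    then have "w \<otimes>\<^bsub>G\<^esub> x = ?v \<otimes>\<^bsub>G\<^esub> s" using wG sG x by (simp add: m_assoc)
    then have "(w \<otimes>\<^bsub>G\<^esub> x) [^]\<^bsub>G\<^esub> n = (?v \<otimes>\<^bsub>G\<^esub> s) [^]\<^bsub>G\<^esub> n" by simp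
    then have xs: "x [^]\<^bsub>G\<^esub> n = s [^]\<^bsub>G\<^esub> n"
      using nat_pow_distrib[OF wG x, of n] nat_pow_distrib[OF vG sG, of n] wn vn x sG by simp
    obtain q where q: "(\<Prod>s\<in>S. m s) = m s * q" using dvd_prodI[OF S(2) s(1)] by blast
    have "x [^]\<^bsub>G\<^esub> ?N = (s [^]\<^bsub>G\<^esub> n) [^]\<^bsub>G\<^esub> (m s * q)"
      using x by (simp add: q nat_pow_pow flip: xs)
    also have "\<dots> = ((s [^]\<^bsub>G\<^esub> m s) [^]\<^bsub>G\<^esub> q) [^]\<^bsub>G\<^esub> n"
      using sG by (simp add: nat_pow_pow mult_ac)
    finally show ?thesis using m[OF s(1)] by simp
  qed
  ultimately show ?thesis using that by blast
qed

theorem theorem3p5: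
  fixes G :: "('a, 'b) monoid_scheme" and T :: "'a topology"
  assumes "topological_group G T"
    and "comm_group G"
    and "torsion_group G"
    and "compact_space T"
    and "Hausdorff_space T"
    and "dense_subgroup_separable G T"
  shows "metrizable_space T \<and> dense_separable T"
proof -
  obtain N :: nat where N: "N > 0" "\<And>x. x \<in> carrier G \<Longrightarrow> x [^]\<^bsub>G\<^esub> N = \<one>\<^bsub>G\<^esub>"
    using compact_torsion_exponent[OF assms(1-5)] by blast
  interpret topological_group G T by fact
  interpret comm_group G by fact
  interpret compact_bounded_group G T N
    by unfold_locales (use N assms in auto)
  have "countable dual"
    using countable_dual countable_dual_torsion_if_separable assms(6) by blast
  then have "metrizable_space T" "second_countable T"
    using countable_dual_imp_metrizable by auto
  then show ?thesis
    unfolding dense_separable_def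
    by (blast intro: second_countable_imp_separable_space second_countable_subtopology)
qed

end
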